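(* Let $Y$ be a fixed compact ANR. To every compact set $X\subseteq Q$ one can associate a numbering $\nu_{[X;Y]}:\subseteq\mathbb N\to[X;Y]$ (a surjective partial function) such that: (1) $\mathrm{dom}(\nu_{[X;Y]})$ is c.e. relative to $X$; (2) the set $\{(i,j)\in\mathrm{dom}(\nu_{[X;Y]})^2:\nu_{[X;Y]}(i)=\nu_{[X;Y]}(j)\}$ is c.e. relative to $X$; (3) for every compact pair $A\subseteq X\subseteq Q$, the set $\{(i,j)\in\mathrm{dom}(\nu_{[X;Y]})\times\mathrm{dom}(\nu_{[A;Y]}):\nu_{[X;Y]}(i)\text{ extends }\nu_{[A;Y]}(j)\}$ is c.e. relative to $(X,A)$; (4) for every compact pair $A\subseteq X\subseteq Q$, the set $\{i\in\mathrm{dom}(\nu_{[A;Y]}):\nu_{[A;Y]}(i)\text{ has a continuous extension to }X\}$ is c.e. relative to $(X,A)$. Here $X$ and $A$ are given as elements of $\mathcal K(Q)$ with the upper Vietoris topology.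
   Context: $Q=[0,1]^{\mathbb N}$ is the Hilbert cube with metric $d_Q(x,y)=\sum_i2^{-i}|x_i-y_i|$. A compact space $Y$ is an ANR (absolute neighborhood retract) if every subset of $Q$ homeomorphic to $Y$ is a retract of some neighborhood of itself in $Q$. For spaces $X,Y$, $[X;Y]$ denotes the set of homotopy classes of continuous maps $X\to Y$. For $A\subseteq X$, a class $[F]\in[X;Y]$ extends a class $[f]\in[A;Y]$ if $F$ is homotopic to an extension of $f$ (equivalently $[F|_A]=[f]$); a class in $[A;Y]$ has a continuous extension to $X$ if some (equivalently every) representative extends continuously to $X$. $\mathcal K(Q)$ is the set of compact subsets of $Q$ with the upper Vietoris topology, whose basis consists of the sets $\{K:K\subseteq U\}$ with $U$ a finite union of rational open balls (rational center with finitely many nonzero coordinates, rational radius), effectively numbered. A set $S\subseteq\mathbb N$ is c.e. relative to $X$ (resp. $(X,A)$) if $S$ is enumeration reducible to the set of indices of basic upper Vietoris neighborhoods of $X$ (resp. of $(X,A)$ in the product space), i.e. there is a single effective procedure producing an enumeration of $S$ from any enumeration of those neighborhoods. *)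

theory Defs
  imports "HOL-Analysis.Analysis" "HOL-Library.Nat_Bijection"
begin

section \<open>Recursively enumerable sets and enumeration reducibility\<close>

text \<open>Programs for the partial recursive functions, and their evaluation on argument lists.\<close>

datatype recf =
    Zero_rf
  | Succ_rf
  | Proj_rf nat
  | Comp_rf recf "recf list"
  | Prec_rf recf recf
  | Mu_rf recf

inductive rf_eval :: "recf \<Rightarrow> nat list \<Rightarrow> nat \<Rightarrow> bool" where
  zero: "rf_eval Zero_rf xs 0"
| succ: "rf_eval Succ_rf [x] (Suc x)"
| proj: "i < length xs \<Longrightarrow> rf_eval (Proj_rf i) xs (xs ! i)"
| comp: "list_all2 (\<lambda>g y. rf_eval g xs y) gs ys \<Longrightarrow> rf_eval f ys z \<Longrightarrow> rf_eval (Comp_rf f gs) xs z"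
| prec_0: "rf_eval f xs y \<Longrightarrow> rf_eval (Prec_rf f g) (0 # xs) y"
| prec_Suc: "rf_eval (Prec_rf f g) (n # xs) y \<Longrightarrow> rf_eval g (n # y # xs) z \<Longrightarrow>
    rf_eval (Prec_rf f g) (Suc n # xs) z"
| mu: "\<forall>m<n. \<exists>y. rf_eval f (m # xs) (Suc y) \<Longrightarrow> rf_eval f (n # xs) 0 \<Longrightarrow> rf_eval (Mu_rf f) xs n"

definition ce_set :: "nat set \<Rightarrow> bool" where
  "ce_set W \<longleftrightarrow> (\<exists>f. W = {x. \<exists>y. rf_eval f [x] y})"

text \<open>\<open>A\<close> is obtained from \<open>B\<close> by the enumeration operator given by a c.e. set of axioms \<open>(n, D)\<close>,
  where finite sets \<open>D\<close> are represented by their canonical (binary) index.\<close>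

definition enum_reducible :: "nat set \<Rightarrow> nat set \<Rightarrow> bool" where
  "enum_reducible A B \<longleftrightarrow>
    (\<exists>W. ce_set W \<and> A = {n. \<exists>u. prod_encode (n, u) \<in> W \<and> set_decode u \<subseteq> B})"


section \<open>The Hilbert cube\<close>

definition hilbert_cube :: "(nat \<Rightarrow> real) set" where
  "hilbert_cube = {x. \<forall>i. 0 \<le> x i \<and> x i \<le> 1}"

definition hc_dist :: "(nat \<Rightarrow> real) \<Rightarrow> (nat \<Rightarrow> real) \<Rightarrow> real" where
  "hc_dist x y = (\<Sum>i. (1/2)^i * \<bar>x i - y i\<bar>)"

definition hc_ball :: "(nat \<Rightarrow> real) \<Rightarrow> real \<Rightarrow> (nat \<Rightarrow> real) set" where
  "hc_ball c r = {x \<in> hilbert_cube. hc_dist c x < r}"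

lemma hc_dist_summable:
  assumes "x \<in> hilbert_cube" "y \<in> hilbert_cube"
  shows "summable (\<lambda>i. (1/2)^i * \<bar>x i - y i\<bar>)"
proof (rule summable_comparison_test)
  have "\<bar>x i - y i\<bar> \<le> 1" for i
    using assms unfolding hilbert_cube_def by (smt (verit) mem_Collect_eq)
  then show "\<exists>N. \<forall>n\<ge>N. norm ((1/2)^n * \<bar>x n - y n\<bar>) \<le> (1/2::real)^n"
    by (auto simp: abs_mult)
qed (auto intro: summable_geometric)

lemma hc_dist_nonneg:
  assumes "x \<in> hilbert_cube" "y \<in> hilbert_cube"
  shows "0 \<le> hc_dist x y"
  unfolding hc_dist_def by (rule suminf_nonneg[OF hc_dist_summable[OF assms]]) simp

text \<open>The absolute value only matters outside the Hilbert cube, where the series may diverge.\<close>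

lemma Metric_space_hilbert_cube: "Metric_space hilbert_cube (\<lambda>x y. \<bar>hc_dist x y\<bar>)"
proof
  show "0 \<le> \<bar>hc_dist x y\<bar>" for x y by simp
  show "\<bar>hc_dist x y\<bar> = \<bar>hc_dist y x\<bar>" for x y
    by (simp add: hc_dist_def abs_minus_commute)
  show "\<bar>hc_dist x y\<bar> = 0 \<longleftrightarrow> x = y" if "x \<in> hilbert_cube" "y \<in> hilbert_cube" for x y
  proof -
    have "hc_dist x y = 0 \<longleftrightarrow> (\<forall>i. (1/2)^i * \<bar>x i - y i\<bar> = 0)"
      unfolding hc_dist_def by (rule suminf_eq_zero_iff[OF hc_dist_summable[OF that]]) simp
    then show ?thesis by (auto simp: fun_eq_iff)
  qed
  show "\<bar>hc_dist x z\<bar> \<le> \<bar>hc_dist x y\<bar> + \<bar>hc_dist y z\<bar>"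
    if "x \<in> hilbert_cube" "y \<in> hilbert_cube" "z \<in> hilbert_cube" for x y z
  proof -
    note sm = hc_dist_summable[OF that(1,2)] hc_dist_summable[OF that(2,3)]
    have "hc_dist x z \<le> (\<Sum>i. (1/2)^i * \<bar>x i - y i\<bar> + (1/2)^i * \<bar>y i - z i\<bar>)"
      unfolding hc_dist_def
    proof (rule suminf_le)
      show "(1/2)^i * \<bar>x i - z i\<bar> \<le> (1/2)^i * \<bar>x i - y i\<bar> + (1/2)^i * \<bar>y i - z i\<bar>" for i
        unfolding distrib_left[symmetric] by (rule mult_left_mono) auto
    qed (use hc_dist_summable[OF that(1,3)] summable_add[OF sm] in auto)
    also have "\<dots> = hc_dist x y + hc_dist y z"
      unfolding hc_dist_def by (rule suminf_add[OF sm, symmetric])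
    finally show ?thesis using that by (simp add: hc_dist_nonneg)
  qed
qed

lemma compact_hilbert_cube: "compact hilbert_cube"
proof -
  have eq: "hilbert_cube = PiE UNIV (\<lambda>_. {0..1})"
    by (auto simp: hilbert_cube_def)
  have "compactin (product_topology (\<lambda>_. euclidean) UNIV) hilbert_cube"
    unfolding eq compactin_PiE by simp
  then show ?thesis
    by (simp add: euclidean_product_topology)
qed

text \<open>The metric induces the product topology, i.e. the subspace topology of \<open>nat \<Rightarrow> real\<close>.\<close>

lemma openin_hilbert_cube:
  "openin (top_of_set hilbert_cube) U \<longleftrightarrow>
    U \<subseteq> hilbert_cube \<and> (\<forall>x\<in>U. \<exists>r>0. hc_ball x r \<subseteq> U)"
proof -
  interpret M: Metric_space hilbert_cube "\<lambda>x y. \<bar>hc_dist x y\<bar>"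
    by (rule Metric_space_hilbert_cube)
  have cont: "continuous_on hilbert_cube (hc_dist c)" if c: "c \<in> hilbert_cube" for c
  proof (rule uniform_limit_theorem)
    show "uniform_limit hilbert_cube (\<lambda>n x. \<Sum>i<n. (1/2)^i * \<bar>c i - x i\<bar>) (hc_dist c) sequentially"
      unfolding hc_dist_def
    proof (rule Weierstrass_m_test)
      show "norm ((1/2)^n * \<bar>c n - x n\<bar>) \<le> (1/2)^n" if "x \<in> hilbert_cube" for n x
      proof -
        have "\<bar>c n - x n\<bar> \<le> 1"
          using c that unfolding hilbert_cube_def by (smt (verit) mem_Collect_eq)
        then show ?thesis by (simp add: abs_mult)
      qed
    qed (simp add: summable_geometric)
    show "\<forall>\<^sub>F n in sequentially. continuous_on hilbert_cube (\<lambda>x. \<Sum>i<n. (1/2)^i * \<bar>c i - x i\<bar>)"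
      by (intro always_eventually allI continuous_intros
        continuous_on_subset[OF continuous_on_product_coordinates subset_UNIV])
  qed simp
  have ball: "openin (top_of_set hilbert_cube) (M.mball c r)" if "c \<in> hilbert_cube" for c r
  proof -
    have "M.mball c r = hilbert_cube \<inter> hc_dist c -` {..<r}"
      using that by (auto simp: hc_dist_nonneg)
    then show ?thesis
      using continuous_openin_preimage_gen[OF cont[OF that] open_lessThan] by simp
  qed
  have "continuous_map (top_of_set hilbert_cube) M.mtopology id"
  proof (clarsimp simp: continuous_map_def)
    fix U assume U: "openin M.mtopology U"
    then have "U \<subseteq> hilbert_cube"
      using openin_subset by fastforce
    then have "{x \<in> hilbert_cube. x \<in> U} = U" by auto
    moreover have "openin (top_of_set hilbert_cube) U"
    proof (subst openin_subopen, intro ballI)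
      fix x assume "x \<in> U"
      then obtain r where "r > 0" "M.mball x r \<subseteq> U"
        using U by (auto simp: M.openin_mtopology)
      then show "\<exists>T. openin (top_of_set hilbert_cube) T \<and> x \<in> T \<and> T \<subseteq> U"
        using ball \<open>x \<in> U\<close> \<open>U \<subseteq> hilbert_cube\<close> by (intro exI[of _ "M.mball x r"]) auto
    qed
    ultimately show "openin (top_of_set hilbert_cube) {x \<in> hilbert_cube. x \<in> U}" by simp
  qed
  then have "homeomorphic_map (top_of_set hilbert_cube) M.mtopology id"
    by (rule continuous_imp_homeomorphic_map)
      (auto simp: compact_space_subtopology compact_hilbert_cube M.Hausdorff_space_mtopology)
  then have "M.mtopology = top_of_set hilbert_cube"
    by (simp add: homeomorphic_map_id)
  moreover have mball_eq: "M.mball x r = hc_ball x r" if "x \<in> hilbert_cube" for x r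
    using that by (auto simp: hc_ball_def hc_dist_nonneg)
  ultimately have "openin (top_of_set hilbert_cube) U \<longleftrightarrow>
      U \<subseteq> hilbert_cube \<and> (\<forall>x. x \<in> U \<longrightarrow> (\<exists>r>0. M.mball x r \<subseteq> U))"
    using M.openin_mtopology[of U] by simp
  also have "\<dots> \<longleftrightarrow> U \<subseteq> hilbert_cube \<and> (\<forall>x\<in>U. \<exists>r>0. hc_ball x r \<subseteq> U)"
    using mball_eq by (auto simp: subset_iff[of U] simp del: M.in_mball)
  finally show ?thesis .
qed

text \<open>Effective numberings: rational centers with finitely many nonzero coordinates, positive
  rational radii, rational balls, and finite unions of rational balls.\<close>

definition rat_center :: "nat \<Rightarrow> nat \<Rightarrow> real" where
  "rat_center n i =
    (let l = list_decode n in
     if i < length l then (case prod_decode (l ! i) of (p, q) \<Rightarrow> min 1 (real p / real (Suc q))) else 0)"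

definition rat_radius :: "nat \<Rightarrow> real" where
  "rat_radius n = (case prod_decode n of (p, q) \<Rightarrow> real (Suc p) / real (Suc q))"

definition rat_ball :: "nat \<Rightarrow> (nat \<Rightarrow> real) set" where
  "rat_ball n = (case prod_decode n of (c, r) \<Rightarrow> hc_ball (rat_center c) (rat_radius r))"

definition rat_open :: "nat \<Rightarrow> (nat \<Rightarrow> real) set" where
  "rat_open n = (\<Union>b \<in> set (list_decode n). rat_ball b)"

lemma range_rat_ball:
  "range rat_ball = {hc_ball c r | c r.
     c \<in> hilbert_cube \<and> (\<forall>i. c i \<in> \<rat>) \<and> finite {i. c i \<noteq> 0} \<and> r \<in> \<rat> \<and> r > 0}"
  (is "_ = ?B")
proof (intro equalityI subsetI)
  fix V assume "V \<in> range rat_ball"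
  then obtain c r where V: "V = hc_ball (rat_center c) (rat_radius r)"
    by (auto simp: rat_ball_def split: prod.splits)
  have "rat_center c i = 0" if "i \<ge> length (list_decode c)" for i
    using that by (simp add: rat_center_def)
  then have "{i. rat_center c i \<noteq> 0} \<subseteq> {..<length (list_decode c)}"
    by (auto simp: not_less intro!: leI)
  then have "finite {i. rat_center c i \<noteq> 0}"
    using finite_subset by blast
  moreover have "rat_center c \<in> hilbert_cube" "rat_center c i \<in> \<rat>" for i
    by (auto simp: rat_center_def hilbert_cube_def Let_def min_def split: prod.splits)
  moreover have "rat_radius r \<in> \<rat>" "rat_radius r > 0"
    by (auto simp: rat_radius_def split: prod.splits)
  ultimately show "V \<in> ?B" using V by blast
next
  fix V assume "V \<in> ?B"
  then obtain c r where V: "V = hc_ball c r" and c: "c \<in> hilbert_cube" "\<And>i. c i \<in> \<rat>"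
    "finite {i. c i \<noteq> 0}" and r: "r \<in> \<rat>" "r > 0" by blast
  have code: "\<exists>p q. x = real p / real (Suc q)" if "x \<in> \<rat>" "x \<ge> 0" for x
  proof -
    obtain m n :: nat where "n \<noteq> 0" "\<bar>x\<bar> = real m / real n"
      using Rats_abs_nat_div_natE[OF \<open>x \<in> \<rat>\<close>] by metis
    then show ?thesis using \<open>x \<ge> 0\<close> by (metis abs_of_nonneg not0_implies_Suc)
  qed
  have "\<forall>i. \<exists>p q. c i = real p / real (Suc q)"
    using c code by (auto simp: hilbert_cube_def)
  then obtain p q where pq: "\<And>i. c i = real (p i) / real (Suc (q i))" by metis
  obtain N where N: "\<And>i. c i \<noteq> 0 \<Longrightarrow> i < N"
    using c(3) finite_nat_set_iff_bounded by auto
  have "rat_center (list_encode (map (\<lambda>i. prod_encode (p i, q i)) [0..<N])) i = c i" for i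
  proof -
    have "c i \<le> 1" using c(1) by (simp add: hilbert_cube_def)
    then show ?thesis using N[of i] by (auto simp: rat_center_def pq min_def)
  qed
  then obtain k where k: "rat_center k = c" by blast
  obtain a b where ab: "r = real a / real (Suc b)"
    using code r by fastforce
  then have "a \<noteq> 0" using r by (intro notI) simp
  then obtain a' where "a = Suc a'" using not0_implies_Suc by blast
  then have "rat_radius (prod_encode (a', b)) = r"
    by (simp add: rat_radius_def ab)
  then have "V = rat_ball (prod_encode (k, prod_encode (a', b)))"
    by (simp add: rat_ball_def V k)
  then show "V \<in> range rat_ball" by blast
qed

lemma range_rat_open: "range rat_open = {\<Union>\<B> | \<B>. finite \<B> \<and> \<B> \<subseteq> range rat_ball}"
proof (intro equalityI subsetI)
  fix V assume "V \<in> range rat_open"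
  then obtain n where "V = \<Union>(rat_ball ` set (list_decode n))"
    by (auto simp: rat_open_def)
  then show "V \<in> {\<Union>\<B> | \<B>. finite \<B> \<and> \<B> \<subseteq> range rat_ball}"
    by (intro CollectI exI[of _ "rat_ball ` set (list_decode n)"]) auto
next
  fix V assume "V \<in> {\<Union>\<B> | \<B>. finite \<B> \<and> \<B> \<subseteq> range rat_ball}"
  then obtain \<B> where \<B>: "V = \<Union>\<B>" "finite \<B>" "\<B> \<subseteq> range rat_ball" by blast
  then obtain I where I: "finite I" "V = \<Union>(rat_ball ` I)"
    using finite_subset_image[OF \<B>(2,3)] by blast
  then obtain l where "set l = I" using finite_list by blast
  then have "V = rat_open (list_encode l)" using I by (simp add: rat_open_def)
  then show "V \<in> range rat_open" by blast
qed


section \<open>Sets c.e. relative to a compact set or a pair of compact sets\<close>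

text \<open>The indices of the basic upper Vietoris neighborhoods \<open>{K. K \<subseteq> rat_open n}\<close> of \<open>X\<close>, and of the
  basic neighborhoods of \<open>(X, A)\<close> in the product space.\<close>

definition upper_nbhds :: "(nat \<Rightarrow> real) set \<Rightarrow> nat set" where
  "upper_nbhds X = {n. X \<subseteq> rat_open n}"

definition upper_nbhds_pair :: "(nat \<Rightarrow> real) set \<Rightarrow> (nat \<Rightarrow> real) set \<Rightarrow> nat set" where
  "upper_nbhds_pair X A = {prod_encode (m, n) | m n. X \<subseteq> rat_open m \<and> A \<subseteq> rat_open n}"

definition ce_relative :: "nat set \<Rightarrow> (nat \<Rightarrow> real) set \<Rightarrow> bool" where
  "ce_relative S X \<longleftrightarrow> enum_reducible S (upper_nbhds X)"

definition ce_relative_pair :: "nat set \<Rightarrow> (nat \<Rightarrow> real) set \<Rightarrow> (nat \<Rightarrow> real) set \<Rightarrow> bool" where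
  "ce_relative_pair S X A \<longleftrightarrow> enum_reducible S (upper_nbhds_pair X A)"


section \<open>Absolute neighborhood retracts\<close>

text \<open>Spaces are metrizable. This has to be required explicitly: a compact space that does not
  embed into the Hilbert cube would satisfy the retraction condition vacuously.\<close>

definition compact_ANR :: "'b topology \<Rightarrow> bool" where
  "compact_ANR Y \<longleftrightarrow> compact_space Y \<and> metrizable_space Y \<and>
    (\<forall>S \<subseteq> hilbert_cube. top_of_set S homeomorphic_space Y \<longrightarrow>
       (\<exists>U N. openin (top_of_set hilbert_cube) U \<and> S \<subseteq> U \<and> U \<subseteq> N \<and> N \<subseteq> hilbert_cube \<and>
          S retract_of N))"


section \<open>Homotopy classes and their extensions\<close>

text \<open>A class is a set of total functions that are continuous on \<open>X\<close>; values outside \<open>X\<close> are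
  irrelevant, and the class is closed under changing them.\<close>

definition homotopy_classes :: "'a topology \<Rightarrow> 'b topology \<Rightarrow> ('a \<Rightarrow> 'b) set set" where
  "homotopy_classes X Y =
    {f. continuous_map X Y f} // {(f, g). homotopic_with (\<lambda>_. True) X Y f g}"

definition class_extends ::
    "'a::topological_space set \<Rightarrow> 'a set \<Rightarrow> 'b topology \<Rightarrow> ('a \<Rightarrow> 'b) set \<Rightarrow> ('a \<Rightarrow> 'b) set \<Rightarrow> bool" where
  "class_extends X A Y \<Phi> \<phi> \<longleftrightarrow>
    (\<exists>F\<in>\<Phi>. \<exists>f\<in>\<phi>. \<exists>G. homotopic_with (\<lambda>_. True) (top_of_set X) Y F G \<and> (\<forall>x\<in>A. G x = f x))"

definition class_extendable ::
    "'a::topological_space set \<Rightarrow> 'a set \<Rightarrow> 'b topology \<Rightarrow> ('a \<Rightarrow> 'b) set \<Rightarrow> bool" where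
  "class_extendable X A Y \<phi> \<longleftrightarrow>
    (\<exists>f\<in>\<phi>. \<exists>F. continuous_map (top_of_set X) Y F \<and> (\<forall>x\<in>A. F x = f x))"

lemma equiv_homotopic:
  "equiv {f. continuous_map X Y f} {(f, g). homotopic_with (\<lambda>_. True) X Y f g}"
  by (rule equivI)
    (auto simp: refl_on_def intro!: symI transI
      dest: homotopic_with_imp_continuous_maps homotopic_with_symD intro: homotopic_with_trans)

text \<open>The equivalent description by restriction: \<open>F\<close> itself represents its restriction to \<open>A\<close>.\<close>

lemma class_extends_iff_restrict:
  assumes "A \<subseteq> X" "\<Phi> \<in> homotopy_classes (top_of_set X) Y" "\<phi> \<in> homotopy_classes (top_of_set A) Y" "F \<in> \<Phi>"
  shows "class_extends X A Y \<Phi> \<phi> \<longleftrightarrow> F \<in> \<phi>"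
proof
  assume "F \<in> \<phi>"
  moreover have "continuous_map (top_of_set X) Y F"
    using in_quotient_imp_subset[OF equiv_homotopic] assms(2,4) unfolding homotopy_classes_def
    by blast
  ultimately show "class_extends X A Y \<Phi> \<phi>"
    unfolding class_extends_def using \<open>F \<in> \<Phi>\<close> homotopic_with_refl by blast
next
  assume "class_extends X A Y \<Phi> \<phi>"
  then obtain F' f G where *: "F' \<in> \<Phi>" "f \<in> \<phi>" "homotopic_with (\<lambda>_. True) (top_of_set X) Y F' G"
    and Gf: "\<And>x. x \<in> A \<Longrightarrow> G x = f x"
    unfolding class_extends_def by blast
  have "homotopic_with (\<lambda>_. True) (top_of_set X) Y F F'"
    using in_quotient_imp_in_rel[OF equiv_homotopic, of \<Phi> _ _ F F'] assms(2,4) *(1)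
    unfolding homotopy_classes_def by blast
  then have "homotopic_with (\<lambda>_. True) (top_of_set X) Y F G"
    using *(3) homotopic_with_trans by blast
  then have "homotopic_with (\<lambda>_. True) (top_of_set A) Y F G"
    using homotopic_from_subtopology[of _ "top_of_set X" Y F G A] \<open>A \<subseteq> X\<close>
    by (simp add: subtopology_subtopology Int_absorb1)
  moreover from this have "homotopic_with (\<lambda>_. True) (top_of_set A) Y G f"
    using Gf by (intro homotopic_with_equal) (auto dest: homotopic_with_imp_continuous_maps)
  ultimately have "homotopic_with (\<lambda>_. True) (top_of_set A) Y f F"
    using homotopic_with_trans homotopic_with_symD by blast
  then show "F \<in> \<phi>"
    using in_quotient_imp_closed[OF equiv_homotopic, of \<phi> _ _ f F] assms(3) *(2)
    unfolding homotopy_classes_def by blast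
qed

end

theory Submission
  imports Defs
begin

text \<open>
  Embed \<open>Y\<close> into the Hilbert cube as a neighborhood retract \<open>S\<close> and fix a finite, sufficiently fine net
  of \<open>S\<close>. A map \<open>X \<rightarrow> S\<close> is described up to homotopy by finitely many rational balls covering \<open>X\<close>, each
  labelled by a point of the net, such that balls that are not formally disjoint carry close labels: a
  partition of unity followed by the retraction produces a map close to all labels, and any two such
  maps are joined by a straight-line homotopy that is pushed into \<open>S\<close> by the retraction. Whether the
  labels of a list of balls match is decidable and does not involve \<open>X\<close>; that the balls cover \<open>X\<close> is a
  single query to the upper Vietoris neighborhoods of \<open>X\<close>.

  Two codes represent homotopic maps iff they are joined by a finite chain of codes over \<open>X\<close> in which
  the labels of consecutive codes match: sample a homotopy at finitely many times and approximate every
  stage by a fine code. This replaces any computation on \<open>X \<times> [0, 1]\<close>. Since a code over \<open>X\<close> is also a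
  code over \<open>A \<subseteq> X\<close> and represents the restricted maps, extension of classes is also expressed by chains
  over \<open>A\<close>.
\<close>


section \<open>Recursive functions and enumeration operators\<close>

text \<open>The obstacle is that upper neighborhoods carry only covering information: those of
  \<open>X\<close> are also upper neighborhoods of every subset of \<open>X\<close>, so no ball can
  be confirmed to meet \<open>X\<close>. Hence a code may contain balls that miss \<open>X\<close>,
  and every condition other than covering is imposed on the list of balls alone. \<open>Y\<close>
  enters the programs only through a finite set of pairs of close labels. Such a set is decidable
  even though it arises from comparisons of real numbers; \<epsilon>, \<delta>, \<eta> and
  \<open>r\<close> themselves are never computed. Different tolerances are used. Labels within one
  code are \<delta>-close, so that \<open>r\<close> sends their average to a point within \<epsilon>
  of them. Labels of two linked codes may differ by 2 \<epsilon>, which puts realizing maps within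
  \<epsilon> + 2 \<epsilon> + \<epsilon> of each other, the width at which segments between them
  stay in \<open>U\<close>. The net has mesh \<eta> with 4 \<eta> at most \<epsilon> and at most
  \<delta>, the room needed to compare labels of fine codes. Errors add up along several links, so
  linking need not be transitive; chains are harmless because homotopy is.\<close>

lemma rf_eval_deterministic: "rf_eval f xs y \<Longrightarrow> rf_eval f xs z \<Longrightarrow> y = z"
proof (induction arbitrary: z rule: rf_eval.induct)
  case (comp xs gs ys f w)
  from comp.prems obtain ys' where ys': "list_all2 (\<lambda>g y. rf_eval g xs y) gs ys'" "rf_eval f ys' z"
    by cases
  have "ys = ys'"
  proof (rule nth_equalityI)
    show "length ys = length ys'"
      using comp.IH(1) ys'(1) by (simp add: list_all2_conv_all_nth)
    show "ys ! i = ys' ! i" if "i < length ys" for i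
      using comp.IH(1) ys'(1) that by (auto simp: list_all2_conv_all_nth)
  qed
  then show ?case using comp.IH(2) ys'(2) by blast
next
  case (prec_Suc f g n xs y w)
  from prec_Suc.prems show ?case
    by cases (use prec_Suc.IH in blast)
next
  case (mu n f xs)
  from mu.prems have z: "\<forall>m<z. \<exists>y. rf_eval f (m # xs) (Suc y)" "rf_eval f (z # xs) 0"
    by (cases; blast)+
  have "\<not> z < n"
  proof
    assume "z < n"
    then obtain y where "\<forall>x. rf_eval f (z # xs) x \<longrightarrow> Suc y = x" using mu.IH(1) by blast
    then show False using z(2) by fastforce
  qed
  moreover have "\<not> n < z"
  proof
    assume "n < z"
    then obtain y where "rf_eval f (n # xs) (Suc y)" using z(1) by blast
    then show False using mu.IH(2) by fastforce
  qed
  ultimately show ?case by simp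
next
  case (zero xs)
  then show ?case by cases auto
next
  case (succ x)
  then show ?case by cases auto
next
  case (proj i xs)
  from proj.prems show ?case by cases auto
next
  case (prec_0 f xs y g)
  from prec_0.prems show ?case by cases (use prec_0.IH in blast)
qed

section \<open>Programs for arithmetic and for Cantor pairing\<close>

lemma rf_eval_Comp1: "rf_eval g xs y \<Longrightarrow> rf_eval f [y] z \<Longrightarrow> rf_eval (Comp_rf f [g]) xs z"
  by (rule rf_eval.comp[where ys = "[y]"]) auto

lemma rf_eval_Comp2:
  "rf_eval g xs y \<Longrightarrow> rf_eval h xs z \<Longrightarrow> rf_eval f [y, z] w \<Longrightarrow> rf_eval (Comp_rf f [g, h]) xs w"
  by (rule rf_eval.comp[where ys = "[y, z]"]) auto

lemma rf_eval_Proj: "i < length xs \<Longrightarrow> y = xs ! i \<Longrightarrow> rf_eval (Proj_rf i) xs y"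
  by (simp add: rf_eval.proj)

lemma rf_eval_add: "\<exists>r. \<forall>m n. rf_eval r [m, n] (m + n)"
proof (intro exI allI)
  fix m n
  show "rf_eval (Prec_rf (Proj_rf 0) (Comp_rf Succ_rf [Proj_rf 1])) [m, n] (m + n)"
  proof (induction m)
    case 0
    then show ?case by (auto intro!: rf_eval.prec_0 rf_eval_Proj)
  next
    case (Suc m)
    then show ?case
      by (auto intro!: rf_eval.prec_Suc rf_eval_Comp1 rf_eval_Proj rf_eval.succ)
  qed
qed

lemma rf_eval_pred: "\<exists>r. \<forall>n. rf_eval r [n] (n - 1)"
proof (intro exI allI)
  fix n
  show "rf_eval (Prec_rf Zero_rf (Proj_rf 0)) [n] (n - 1)"
    by (induction n) (auto intro!: rf_eval.prec_0 rf_eval.prec_Suc rf_eval.zero rf_eval_Proj)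
qed

text \<open>Iterated predecessor. The recursion runs on the first argument of a program, so the
  subtrahend comes first.\<close>

lemma rf_eval_diff: "\<exists>r. \<forall>m n. rf_eval r [m, n] (n - m)"
proof -
  obtain p where p: "\<And>n. rf_eval p [n] (n - 1)" using rf_eval_pred by blast
  have "rf_eval (Prec_rf (Proj_rf 0) (Comp_rf p [Proj_rf 1])) [m, n] (n - m)" for m n
  proof (induction m)
    case 0
    then show ?case by (auto intro!: rf_eval.prec_0 rf_eval_Proj)
  next
    case (Suc m)
    show ?case
    proof (rule rf_eval.prec_Suc[OF Suc], rule rf_eval_Comp1[OF rf_eval_Proj])
      show "rf_eval p [n - m] (n - Suc m)" using p[of "n - m"] by simp
    qed auto
  qed
  then show ?thesis by blast
qed

lemma rf_eval_triangle: "\<exists>r. \<forall>n. rf_eval r [n] (triangle n)"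
proof -
  obtain a where a: "\<And>m n. rf_eval a [m, n] (m + n)" using rf_eval_add by blast
  have "rf_eval (Prec_rf Zero_rf (Comp_rf a [Proj_rf 1, Comp_rf Succ_rf [Proj_rf 0]])) [n] (triangle n)"
    for n
  proof (induction n)
    case 0
    then show ?case by (auto intro: rf_eval.prec_0 rf_eval.zero)
  next
    case (Suc n)
    show ?case unfolding triangle_Suc
      by (rule rf_eval.prec_Suc[OF Suc], rule rf_eval_Comp2[OF rf_eval_Proj rf_eval_Comp1[OF rf_eval_Proj rf_eval.succ] a])
        auto
  qed
  then show ?thesis by blast
qed

lemma rf_eval_prod_encode: "\<exists>r. \<forall>m n. rf_eval r [m, n] (prod_encode (m, n))"
proof -
  obtain a t where a: "\<And>m n. rf_eval a [m, n] (m + n)" and t: "\<And>n. rf_eval t [n] (triangle n)"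
    using rf_eval_add rf_eval_triangle by blast
  have "rf_eval (Comp_rf a [Comp_rf t [a], Proj_rf 0]) [m, n] (prod_encode (m, n))" for m n
    unfolding prod_encode_def by (auto intro!: rf_eval_Comp2 rf_eval_Comp1 a t rf_eval_Proj)
  then show ?thesis by blast
qed

definition p1 :: "nat \<Rightarrow> nat" where "p1 n = fst (prod_decode n)"
definition p2 :: "nat \<Rightarrow> nat" where "p2 n = snd (prod_decode n)"

lemma p1_prod_encode [simp]: "p1 (prod_encode (a, b)) = a"
  and p2_prod_encode [simp]: "p2 (prod_encode (a, b)) = b"
  and prod_encode_p1_p2 [simp]: "prod_encode (p1 n, p2 n) = n"
  by (simp_all add: p1_def p2_def)

lemma triangle_mono: "m \<le> n \<Longrightarrow> triangle m \<le> triangle n"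
  by (induction n) (auto simp: le_Suc_eq)

text \<open>\<open>p1 n + p2 n\<close> is the least \<open>s\<close> with \<open>n < triangle (Suc s)\<close>.\<close>

lemma rf_eval_p1_plus_p2: "\<exists>r. \<forall>n. rf_eval r [n] (p1 n + p2 n)"
proof -
  obtain d t where d: "\<And>m n. rf_eval d [m, n] (n - m)" and t: "\<And>n. rf_eval t [n] (triangle n)"
    using rf_eval_diff rf_eval_triangle by blast
  \<comment> \<open>The truncated difference vanishes exactly when
    \<open>n < triangle (Suc s)\<close>, so minimization stops at the desired
    \<open>s\<close>.\<close>
  define g where "g = Comp_rf d [Comp_rf t [Comp_rf Succ_rf [Proj_rf 0]], Comp_rf Succ_rf [Proj_rf 1]]"
  have g: "rf_eval g [s, n] (Suc n - triangle (Suc s))" for s n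
    unfolding g_def
    by (rule rf_eval_Comp2[OF rf_eval_Comp1[OF rf_eval_Comp1[OF rf_eval_Proj rf_eval.succ] t]
          rf_eval_Comp1[OF rf_eval_Proj rf_eval.succ] d]) auto
  have "rf_eval (Mu_rf g) [n] (p1 n + p2 n)" for n
  proof (rule rf_eval.mu)
    have n: "n = triangle (p1 n + p2 n) + p1 n"
      using prod_encode_p1_p2[of n] unfolding prod_encode_def by simp
    show "\<forall>s<p1 n + p2 n. \<exists>y. rf_eval g [s, n] (Suc y)"
    proof (intro allI impI)
      fix s assume "s < p1 n + p2 n"
      then have "triangle (Suc s) \<le> n"
        using triangle_mono[of "Suc s" "p1 n + p2 n"] n by linarith
      then have "Suc n - triangle (Suc s) = Suc (n - triangle (Suc s))" by linarith
      then show "\<exists>y. rf_eval g [s, n] (Suc y)" using g[of s n] by metis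
    qed
    have "Suc n - triangle (Suc (p1 n + p2 n)) = 0" using n by simp
    then show "rf_eval g [p1 n + p2 n, n] 0" using g by metis
  qed
  then show ?thesis by blast
qed

text \<open>Since \<open>prod_encode (a, b)\<close> is \<open>triangle (a + b) + a\<close>, both
  coordinates follow from their sum by subtraction.\<close>

lemma rf_eval_p1: "\<exists>r. \<forall>n. rf_eval r [n] (p1 n)"
  and rf_eval_p2: "\<exists>r. \<forall>n. rf_eval r [n] (p2 n)"
proof -
  obtain d t s where d: "\<And>m n. rf_eval d [m, n] (n - m)" and t: "\<And>n. rf_eval t [n] (triangle n)"
    and s: "\<And>n. rf_eval s [n] (p1 n + p2 n)"
    using rf_eval_diff rf_eval_triangle rf_eval_p1_plus_p2 by blast
  define f where "f = Comp_rf d [Comp_rf t [s], Proj_rf 0]"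
  have "n - triangle (p1 n + p2 n) = p1 n" for n
    using prod_encode_p1_p2[of n] unfolding prod_encode_def by simp
  then have f: "rf_eval f [n] (p1 n)" for n
    unfolding f_def
    using rf_eval_Comp2[OF rf_eval_Comp1[OF s t] rf_eval_Proj[of 0 "[n]" n] d] by simp
  then show "\<exists>r. \<forall>n. rf_eval r [n] (p1 n)" by blast
  have "rf_eval (Comp_rf d [f, s]) [n] (p2 n)" for n
    using rf_eval_Comp2[OF f s d, of n] by simp
  then show "\<exists>r. \<forall>n. rf_eval r [n] (p2 n)" by blast
qed

section \<open>Closure properties of recursive functions and decidable predicates\<close>

definition recursive :: "(nat \<Rightarrow> nat) \<Rightarrow> bool" where
  "recursive f \<longleftrightarrow> (\<exists>r. \<forall>x. rf_eval r [x] (f x))"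

text \<open>Several arguments are packed into one number, so that the closure lemmas deal with a
  single free variable.\<close>

definition recursive2 :: "(nat \<Rightarrow> nat \<Rightarrow> nat) \<Rightarrow> bool" where
  "recursive2 f \<longleftrightarrow> recursive (\<lambda>z. f (p1 z) (p2 z))"

definition recursive3 :: "(nat \<Rightarrow> nat \<Rightarrow> nat \<Rightarrow> nat) \<Rightarrow> bool" where
  "recursive3 f \<longleftrightarrow> recursive (\<lambda>z. f (p1 z) (p1 (p2 z)) (p2 (p2 z)))"

definition decidable :: "(nat \<Rightarrow> bool) \<Rightarrow> bool" where
  "decidable P \<longleftrightarrow> recursive (\<lambda>x. of_bool (P x))"

definition decidable2 :: "(nat \<Rightarrow> nat \<Rightarrow> bool) \<Rightarrow> bool" where
  "decidable2 P \<longleftrightarrow> decidable (\<lambda>z. P (p1 z) (p2 z))"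

definition decidable3 :: "(nat \<Rightarrow> nat \<Rightarrow> nat \<Rightarrow> bool) \<Rightarrow> bool" where
  "decidable3 P \<longleftrightarrow> decidable (\<lambda>z. P (p1 z) (p1 (p2 z)) (p2 (p2 z)))"

lemma recursive_id: "recursive (\<lambda>x. x)"
  unfolding recursive_def by (rule exI[of _ "Proj_rf 0"]) (auto intro: rf_eval_Proj)

lemma recursive_comp:
  assumes "recursive f" "recursive g"
  shows "recursive (\<lambda>x. f (g x))"
proof -
  obtain r s where "\<And>x. rf_eval r [x] (f x)" "\<And>x. rf_eval s [x] (g x)"
    using assms unfolding recursive_def by blast
  then have "rf_eval (Comp_rf r [s]) [x] (f (g x))" for x
    by (intro rf_eval_Comp1)
  then show ?thesis unfolding recursive_def by blast
qed

lemma recursive_comp2: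
  assumes "\<exists>r. \<forall>m n. rf_eval r [m, n] (F m n)" "recursive f" "recursive g"
  shows "recursive (\<lambda>x. F (f x) (g x))"
proof -
  obtain r s t where "\<And>m n. rf_eval r [m, n] (F m n)" "\<And>x. rf_eval s [x] (f x)"
    "\<And>x. rf_eval t [x] (g x)"
    using assms unfolding recursive_def by blast
  then have "rf_eval (Comp_rf r [s, t]) [x] (F (f x) (g x))" for x
    by (intro rf_eval_Comp2)
  then show ?thesis unfolding recursive_def by blast
qed

lemma recursive_Suc: "recursive g \<Longrightarrow> recursive (\<lambda>x. Suc (g x))"
  by (rule recursive_comp) (auto simp: recursive_def intro: rf_eval.succ)

lemma recursive_const: "recursive (\<lambda>_. c)"
proof (induction c)
  case 0
  then show ?case unfolding recursive_def using rf_eval.zero by blast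
qed (rule recursive_Suc)

lemma recursive_p1: "recursive g \<Longrightarrow> recursive (\<lambda>x. p1 (g x))"
  by (rule recursive_comp) (simp add: recursive_def rf_eval_p1)

lemma recursive_p2: "recursive g \<Longrightarrow> recursive (\<lambda>x. p2 (g x))"
  by (rule recursive_comp) (simp add: recursive_def rf_eval_p2)

lemma recursive_add: "recursive f \<Longrightarrow> recursive g \<Longrightarrow> recursive (\<lambda>x. f x + g x)"
  by (rule recursive_comp2[OF rf_eval_add])

lemma recursive_diff:
  assumes "recursive f" "recursive g"
  shows "recursive (\<lambda>x. f x - g x)"
  using recursive_comp2[OF rf_eval_diff assms(2,1)] .

lemma recursive_prod_encode:
  "recursive f \<Longrightarrow> recursive g \<Longrightarrow> recursive (\<lambda>x. prod_encode (f x, g x))"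
  by (rule recursive_comp2[OF rf_eval_prod_encode])

lemma recursive2_comp:
  "recursive2 f \<Longrightarrow> recursive g \<Longrightarrow> recursive h \<Longrightarrow> recursive (\<lambda>x. f (g x) (h x))"
  using recursive_comp[of "\<lambda>z. f (p1 z) (p2 z)" "\<lambda>x. prod_encode (g x, h x)"]
  by (simp add: recursive2_def recursive_prod_encode)

lemma decidable_comp: "decidable P \<Longrightarrow> recursive g \<Longrightarrow> decidable (\<lambda>x. P (g x))"
  unfolding decidable_def by (rule recursive_comp)

lemma decidable2_comp:
  "decidable2 P \<Longrightarrow> recursive g \<Longrightarrow> recursive h \<Longrightarrow> decidable (\<lambda>x. P (g x) (h x))"
  using decidable_comp[of "\<lambda>z. P (p1 z) (p2 z)" "\<lambda>x. prod_encode (g x, h x)"]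
  by (simp add: decidable2_def recursive_prod_encode)

text \<open>The one form of primitive recursion used below: products, powers, bounded quantifiers
  and access to list codes are instances. Base, step and number of steps may all depend on
  \<open>x\<close>.\<close>

lemma recursive_rec_nat:
  assumes h: "recursive h" and F: "recursive3 F" and g: "recursive g"
  shows "recursive (\<lambda>x. rec_nat (h x) (F x) (g x))"
proof -
  obtain rh rF rg pe where rh: "\<And>x. rf_eval rh [x] (h x)"
    and rF: "\<And>z. rf_eval rF [z] (F (p1 z) (p1 (p2 z)) (p2 (p2 z)))"
    and rg: "\<And>x. rf_eval rg [x] (g x)" and pe: "\<And>m n. rf_eval pe [m, n] (prod_encode (m, n))"
    using assms rf_eval_prod_encode unfolding recursive_def recursive3_def by blast
  \<comment> \<open>A step of \<open>Prec_rf\<close> receives counter, previous value and parameter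
    in this order; they are repacked into the argument order of \<open>F\<close>.\<close>
  define step where "step = Comp_rf rF [Comp_rf pe [Proj_rf 2, Comp_rf pe [Proj_rf 0, Proj_rf 1]]]"
  have step: "rf_eval step [k, y, x] (F x k y)" for k y x
  proof -
    have a: "rf_eval (Comp_rf pe [Proj_rf 0, Proj_rf 1]) [k, y, x] (prod_encode (k, y))"
      by (rule rf_eval_Comp2[OF rf_eval_Proj rf_eval_Proj pe]) auto
    have "rf_eval (Comp_rf pe [Proj_rf 2, Comp_rf pe [Proj_rf 0, Proj_rf 1]]) [k, y, x]
        (prod_encode (x, prod_encode (k, y)))"
      by (intro rf_eval_Comp2[OF rf_eval_Proj a pe]) auto
    then show ?thesis
      unfolding step_def using rF[of "prod_encode (x, prod_encode (k, y))"]
      by (intro rf_eval_Comp1) auto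
  qed
  have "rf_eval (Prec_rf rh step) [n, x] (rec_nat (h x) (F x) n)" for n x
  proof (induction n)
    case 0
    then show ?case by (auto intro!: rf_eval.prec_0 rh)
  next
    case (Suc n)
    show ?case using rf_eval.prec_Suc[OF Suc step] by simp
  qed
  then have "rf_eval (Comp_rf (Prec_rf rh step) [rg, Proj_rf 0]) [x] (rec_nat (h x) (F x) (g x))" for x
    by (intro rf_eval_Comp2[OF rg rf_eval_Proj]) auto
  then show ?thesis unfolding recursive_def by blast
qed

lemmas recursive_intros = recursive_id recursive_const recursive_Suc recursive_p1 recursive_p2
  recursive_add recursive_diff recursive_prod_encode

lemma recursive_mult:
  assumes "recursive f" "recursive g"
  shows "recursive (\<lambda>x. f x * g x)"
proof -
  have "rec_nat 0 (\<lambda>_ y. y + b) a = a * b" for a b :: nat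
    by (induction a) auto
  moreover have "recursive3 (\<lambda>x _ y. y + g x)"
    unfolding recursive3_def by (intro recursive_intros recursive_comp[OF assms(2)])
  ultimately show ?thesis
    using recursive_rec_nat[OF recursive_const[of 0] _ assms(1), of "\<lambda>x _ y. y + g x"] by simp
qed

lemma recursive_power:
  assumes "recursive f" "recursive g"
  shows "recursive (\<lambda>x. f x ^ g x)"
proof -
  have "rec_nat 1 (\<lambda>_ y. b * y) a = b ^ a" for a b :: nat
    by (induction a) auto
  moreover have "recursive3 (\<lambda>x _ y. f x * y)"
    unfolding recursive3_def by (intro recursive_mult recursive_intros recursive_comp[OF assms(1)])
  ultimately show ?thesis
    using recursive_rec_nat[OF recursive_const[of 1] _ assms(2), of "\<lambda>x _ y. f x * y"] by simp
qed

lemma decidable_not: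
  assumes "decidable P"
  shows "decidable (\<lambda>x. \<not> P x)"
proof -
  have "of_bool (\<not> Q) = (1::nat) - of_bool Q" for Q by simp
  then show ?thesis
    using recursive_diff[OF recursive_const[of 1] assms[unfolded decidable_def]]
    unfolding decidable_def by simp
qed

lemma decidable_conj:
  assumes "decidable P" "decidable Q"
  shows "decidable (\<lambda>x. P x \<and> Q x)"
  using recursive_mult[of "\<lambda>x. of_bool (P x)" "\<lambda>x. of_bool (Q x)"] assms
  unfolding decidable_def of_bool_conj by simp

lemma decidable_disj:
  assumes "decidable P" "decidable Q"
  shows "decidable (\<lambda>x. P x \<or> Q x)"
  using decidable_not[OF decidable_conj[OF assms[THEN decidable_not]]] by simp

lemma decidable_imp:
  assumes "decidable P" "decidable Q"
  shows "decidable (\<lambda>x. P x \<longrightarrow> Q x)"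
  using decidable_disj[OF decidable_not[OF assms(1)] assms(2)] by simp

lemma decidable_le:
  assumes "recursive f" "recursive g"
  shows "decidable (\<lambda>x. f x \<le> g x)"
proof -
  have eq: "of_bool (a \<le> b) = 1 - (a - b)" for a b :: nat by (cases "a \<le> b") simp_all
  show ?thesis
    unfolding decidable_def eq by (intro recursive_diff recursive_const assms)
qed

lemma decidable_less:
  assumes "recursive f" "recursive g"
  shows "decidable (\<lambda>x. f x < g x)"
  using decidable_le[OF recursive_Suc[OF assms(1)] assms(2)] by (simp add: Suc_le_eq)

lemma decidable_eq:
  assumes "recursive f" "recursive g"
  shows "decidable (\<lambda>x. f x = g x)"
proof -
  have eq: "a = b \<longleftrightarrow> a \<le> b \<and> b \<le> a" for a b :: nat by (rule order_eq_iff)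
  show ?thesis
    using decidable_conj[OF decidable_le[OF assms] decidable_le[OF assms(2,1)]]
    unfolding eq .
qed

text \<open>The elements may be of any origin. This admits sets of label pairs that are selected by
  real inequalities.\<close>

lemma decidable_finite:
  assumes "finite F" "recursive f"
  shows "decidable (\<lambda>x. f x \<in> F)"
  using assms(1)
proof induction
  case empty
  then show ?case by (simp add: decidable_def recursive_const)
next
  case (insert a F)
  then show ?case
    using decidable_disj[OF decidable_eq[OF assms(2) recursive_const[of a]] insert.IH] by simp
qed

text \<open>A bounded quantifier is a product of truth values, computed by recursion on the
  bound.\<close>

lemma decidable_all_less:
  assumes "decidable2 P" "recursive g"
  shows "decidable (\<lambda>x. \<forall>k<g x. P x k)"
proof -
  have "rec_nat 1 (\<lambda>k y. y * of_bool (Q k)) n = (of_bool (\<forall>k<n. Q k) :: nat)" for Q n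
    by (induction n) (auto simp: less_Suc_eq)
  moreover have "recursive3 (\<lambda>x k y. y * of_bool (P x k))"
    unfolding recursive3_def
    by (intro recursive_mult recursive_intros
        decidable2_comp[OF assms(1), unfolded decidable_def])
  ultimately show ?thesis
    using recursive_rec_nat[OF recursive_const[of 1] _ assms(2), of "\<lambda>x k y. y * of_bool (P x k)"]
    unfolding decidable_def by simp
qed

lemma decidable_ex_less: "decidable2 P \<Longrightarrow> recursive g \<Longrightarrow> decidable (\<lambda>x. \<exists>k<g x. P x k)"
  using decidable_not[OF decidable_all_less[of "\<lambda>x k. \<not> P x k" g]]
  by (simp add: decidable2_def decidable_not)

lemma recursive_if:
  assumes "decidable P" "recursive f" "recursive g"
  shows "recursive (\<lambda>x. if P x then f x else g x)"
proof -
  have eq: "(if Q then a else b) = of_bool Q * a + (1 - of_bool Q) * b" for Q and a b :: nat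
    by simp
  show ?thesis
    unfolding eq
    by (intro recursive_add recursive_mult recursive_diff recursive_const assms assms(1)[unfolded decidable_def])
qed

lemma recursive_min: "recursive f \<Longrightarrow> recursive g \<Longrightarrow> recursive (\<lambda>x. min (f x) (g x))"
  unfolding min_def by (intro recursive_if decidable_le)

lemmas decidable_intros = decidable_not decidable_conj decidable_disj decidable_imp decidable_le
  decidable_less decidable_eq

section \<open>Unbounded search and enumeration operators\<close>

lemma ce_set_ex:
  assumes "decidable2 P"
  shows "ce_set {x. \<exists>n. P x n}"
proof -
  \<comment> \<open>Minimization looks for a zero and has its search variable first, so the negated
    predicate is computed with exchanged arguments.\<close>
  have "decidable (\<lambda>z. \<not> P (p2 z) (p1 z))"
    by (intro decidable_not decidable2_comp[OF assms] recursive_intros)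
  then obtain r where r: "\<And>z. rf_eval r [z] (of_bool (\<not> P (p2 z) (p1 z)))"
    unfolding decidable_def recursive_def by blast
  obtain pe where pe: "\<And>m n. rf_eval pe [m, n] (prod_encode (m, n))"
    using rf_eval_prod_encode by blast
  define f where "f = Comp_rf r [pe]"
  have f: "rf_eval f [n, x] (of_bool (\<not> P x n))" for n x
    using r[of "prod_encode (n, x)"] unfolding f_def by (intro rf_eval_Comp1[OF pe]) simp
  have "(\<exists>y. rf_eval (Mu_rf f) [x] y) \<longleftrightarrow> (\<exists>n. P x n)" for x
  proof
    assume "\<exists>y. rf_eval (Mu_rf f) [x] y"
    then obtain y where "rf_eval (Mu_rf f) [x] y" by blast
    then have "rf_eval f [y, x] 0" by cases
    then have "of_bool (\<not> P x y) = (0::nat)" using f rf_eval_deterministic by blast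
    then show "\<exists>n. P x n" by auto
  next
    assume ex: "\<exists>n. P x n"
    have "rf_eval (Mu_rf f) [x] (LEAST n. P x n)"
    proof (rule rf_eval.mu)
      show "\<forall>m<LEAST n. P x n. \<exists>y. rf_eval f [m, x] (Suc y)"
        using f not_less_Least by (metis One_nat_def of_bool_eq(2))
      show "rf_eval f [LEAST n. P x n, x] 0"
        using f[of "LEAST n. P x n" x] LeastI_ex[OF ex] by simp
    qed
    then show "\<exists>y. rf_eval (Mu_rf f) [x] y" by blast
  qed
  then show ?thesis unfolding ce_set_def by blast
qed

text \<open>Bit \<open>n\<close> of \<open>u\<close> is set iff the quotient of \<open>u\<close> by
  \<open>2 ^ n\<close> is odd. Writing this quotient as \<open>2 * q + 1\<close> with bounded
  \<open>q\<close> avoids a program for division.\<close>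

lemma decidable_set_decode:
  assumes "recursive f" "recursive g"
  shows "decidable (\<lambda>x. f x \<in> set_decode (g x))"
proof -
  have bit: "n \<in> set_decode u \<longleftrightarrow> (\<exists>q<Suc u. (2 * q + 1) * 2 ^ n \<le> u \<and> u < (2 * q + 2) * 2 ^ n)"
    for n u :: nat
  proof -
    have pos: "0 < (2::nat) ^ n" by simp
    have "u div 2 ^ n = d \<longleftrightarrow> d * 2 ^ n \<le> u \<and> u < Suc d * 2 ^ n" for d
    proof
      assume "u div 2 ^ n = d"
      then have "d * 2 ^ n + u mod 2 ^ n = u"
        using div_mult_mod_eq[of u "2 ^ n"] by simp
      then show "d * 2 ^ n \<le> u \<and> u < Suc d * 2 ^ n"
        using mod_less_divisor[OF pos, of u] unfolding mult_Suc by (intro conjI; linarith)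
    qed (auto simp: mult.commute intro: div_nat_eqI)
    moreover have "odd (u div 2 ^ n) \<longleftrightarrow> (\<exists>q<Suc u. u div 2 ^ n = 2 * q + 1)"
    proof
      assume "odd (u div 2 ^ n)"
      then obtain q where "u div 2 ^ n = 2 * q + 1" by (rule oddE)
      moreover have "u div 2 ^ n \<le> u" by (rule div_le_dividend)
      ultimately show "\<exists>q<Suc u. u div 2 ^ n = 2 * q + 1" by (intro exI[of _ q]) simp
    qed auto
    ultimately show ?thesis unfolding set_decode_def by simp
  qed
  have "decidable2 (\<lambda>x q. (2 * q + 1) * 2 ^ f x \<le> g x \<and> g x < (2 * q + 2) * 2 ^ f x)"
    unfolding decidable2_def
    by (intro decidable_intros recursive_mult recursive_power recursive_intros
        recursive_comp[OF assms(1)] recursive_comp[OF assms(2)])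
  then show ?thesis
    unfolding bit by (intro decidable_ex_less recursive_Suc assms)
qed

text \<open>The normal form for all reductions below: a certificate \<open>c\<close> is searched
  for, \<open>R\<close> is decided, and a computable list of queries is put to \<open>B\<close>. The
  axioms are the pairs of \<open>n\<close> with a finite set containing all queries of some
  certificate.\<close>

lemma enum_reducible_queries:
  assumes R: "decidable2 R" and h: "recursive2 h" and q: "recursive3 q"
  shows "enum_reducible {n. \<exists>c. R n c \<and> (\<forall>k<h n c. q n c k \<in> B)} B"
proof -
  define P where "P x c \<longleftrightarrow> R (p1 x) c \<and> (\<forall>k<h (p1 x) c. q (p1 x) c k \<in> set_decode (p2 x))" for x c
  have q': "recursive (\<lambda>z. q (f z) (g z) (k z))" if "recursive f" "recursive g" "recursive k" for f g k
    using recursive_comp[OF q[unfolded recursive3_def],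
        of "\<lambda>z. prod_encode (f z, prod_encode (g z, k z))"] that
    by (simp add: recursive_prod_encode)
  have "decidable2 P"
    unfolding P_def decidable2_def
    by (intro decidable_conj decidable2_comp[OF R] decidable_all_less recursive2_comp[OF h]
        recursive_intros decidable_set_decode q' decidable2_def[THEN iffD2])
  then have "ce_set {x. \<exists>c. P x c}" by (rule ce_set_ex)
  moreover have "(\<exists>c. R n c \<and> (\<forall>k<h n c. q n c k \<in> B)) \<longleftrightarrow>
      (\<exists>u. prod_encode (n, u) \<in> {x. \<exists>c. P x c} \<and> set_decode u \<subseteq> B)" for n
  proof
    assume "\<exists>c. R n c \<and> (\<forall>k<h n c. q n c k \<in> B)"
    then obtain c where c: "R n c" "\<forall>k<h n c. q n c k \<in> B" by blast
    have "set_decode (set_encode (q n c ` {..<h n c})) = q n c ` {..<h n c}"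
      by (simp add: set_encode_inverse)
    then show "\<exists>u. prod_encode (n, u) \<in> {x. \<exists>c. P x c} \<and> set_decode u \<subseteq> B"
      using c unfolding P_def by (intro exI[of _ "set_encode (q n c ` {..<h n c})"]) auto
  next
    assume "\<exists>u. prod_encode (n, u) \<in> {x. \<exists>c. P x c} \<and> set_decode u \<subseteq> B"
    then show "\<exists>c. R n c \<and> (\<forall>k<h n c. q n c k \<in> B)" unfolding P_def by auto
  qed
  ultimately show ?thesis unfolding enum_reducible_def by blast
qed

text \<open>A list code is 0 for the empty list and \<open>Suc (prod_encode (x, t))\<close>
  otherwise, so \<open>p2 (y - 1)\<close> codes the tail. The empty list stays fixed because
  \<open>prod_decode 0 = (0, 0)\<close>.\<close>

definition drop_code :: "nat \<Rightarrow> nat \<Rightarrow> nat" where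
  "drop_code n k = rec_nat n (\<lambda>_ y. p2 (y - 1)) k"

definition nth_code :: "nat \<Rightarrow> nat \<Rightarrow> nat" where
  "nth_code n k = p1 (drop_code n k - 1)"

lemma list_decode_drop_code: "list_decode (drop_code n k) = drop k (list_decode n)"
proof (induction k)
  case (Suc k)
  have "list_decode (p2 (m - 1)) = tl (list_decode m)" for m
  proof (cases m)
    case 0
    have "prod_decode 0 = (0, 0)" by (simp add: prod_decode_def prod_decode_aux.simps)
    then show ?thesis by (simp add: 0 p2_def)
  qed (simp add: p2_def split: prod.splits)
  then show ?case
    using Suc by (simp add: drop_code_def drop_Suc tl_drop)
qed (simp add: drop_code_def)

text \<open>Comparison with 0 tests whether a position lies in the list, in place of a program for
  the length.\<close>

lemma drop_code_eq_0_iff: "drop_code n k = 0 \<longleftrightarrow> length (list_decode n) \<le> k"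
proof -
  have "m = 0 \<longleftrightarrow> list_decode m = []" for m
    using list_decode_inverse[of m] by (cases m) auto
  then show ?thesis by (simp add: list_decode_drop_code)
qed

lemma nth_code_eq: "nth_code n k = (if k < length (list_decode n) then list_decode n ! k else 0)"
proof (cases "drop_code n k")
  case 0
  have "prod_decode 0 = (0, 0)" by (simp add: prod_decode_def prod_decode_aux.simps)
  then show ?thesis using 0 drop_code_eq_0_iff[of n k] by (simp add: nth_code_def p1_def)
next
  case (Suc m)
  then have k: "k < length (list_decode n)" using drop_code_eq_0_iff[of n k] by simp
  have "p1 m # list_decode (p2 m) = list_decode (drop_code n k)"
    unfolding Suc by (simp add: p1_def p2_def split: prod.splits)
  also have "\<dots> = drop k (list_decode n)" by (rule list_decode_drop_code)
  finally show ?thesis using k Suc by (metis Cons_nth_drop_Suc diff_Suc_1 list.inject nth_code_def)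
qed

text \<open>Thus the code itself bounds quantifiers over the positions of a list.\<close>

lemma length_list_decode_le: "length (list_decode n) \<le> n"
proof -
  have "length l \<le> list_encode l" for l
  proof (induction l)
    case (Cons x l)
    then show ?case using le_prod_encode_2[of "list_encode l" x] by simp
  qed simp
  from this[of "list_decode n"] show ?thesis by simp
qed

lemma recursive_drop_code: "recursive f \<Longrightarrow> recursive g \<Longrightarrow> recursive (\<lambda>x. drop_code (f x) (g x))"
  unfolding drop_code_def by (intro recursive_rec_nat) (auto simp: recursive3_def intro!: recursive_intros)

lemma recursive_nth_code: "recursive f \<Longrightarrow> recursive g \<Longrightarrow> recursive (\<lambda>x. nth_code (f x) (g x))"
  unfolding nth_code_def by (intro recursive_intros recursive_drop_code)


section \<open>Lists of labelled balls\<close>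

text \<open>The distance \<open>SUP i. 2\<^sup>-\<^sup>i \<bar>u i - v i\<bar>\<close> is used instead of \<open>hc_dist\<close>: it is bounded by \<open>hc_dist\<close>, and
  disjointness of two of its balls is witnessed by a single coordinate.\<close>

definition near :: "real \<Rightarrow> (nat \<Rightarrow> real) \<Rightarrow> (nat \<Rightarrow> real) \<Rightarrow> bool" where
  "near d u v \<longleftrightarrow> (\<forall>i. \<bar>u i - v i\<bar> < 2 ^ i * d)"

text \<open>By compactness, an open condition that holds on a closed box persists on a slightly
  larger open one; see \<open>near_gap\<close>.\<close>

definition near_le :: "real \<Rightarrow> (nat \<Rightarrow> real) \<Rightarrow> (nat \<Rightarrow> real) \<Rightarrow> bool" where
  "near_le d u v \<longleftrightarrow> (\<forall>i. \<bar>u i - v i\<bar> \<le> 2 ^ i * d)"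

definition center :: "nat \<Rightarrow> nat \<Rightarrow> real" where "center b = rat_center (p1 b)"
definition radius :: "nat \<Rightarrow> real" where "radius b = rat_radius (p2 b)"

lemma rat_ball_eq: "rat_ball b = hc_ball (center b) (radius b)"
  by (simp add: rat_ball_def center_def radius_def p1_def p2_def split: prod.splits)

text \<open>Failure means exactly that the two open boxes meet, for instance at the point dividing
  the segment between the centers in the ratio of the radii. It does not imply a common point of the
  balls.\<close>

definition apart :: "nat \<Rightarrow> nat \<Rightarrow> bool" where
  "apart b b' \<longleftrightarrow> \<not> near (radius b + radius b') (center b) (center b')"

text \<open>The minimum with the denominator reproduces the truncation at 1 in
  \<open>rat_center\<close>. Past the end of the list \<open>nth_code\<close> returns 0, which gives
  the coordinate 0.\<close>

definition center_num :: "nat \<Rightarrow> nat \<Rightarrow> nat" where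
  "center_num b i = min (p1 (nth_code (p1 b) i)) (Suc (p2 (nth_code (p1 b) i)))"

definition center_den :: "nat \<Rightarrow> nat \<Rightarrow> nat" where
  "center_den b i = Suc (p2 (nth_code (p1 b) i))"

lemma p1_0 [simp]: "p1 0 = 0"
  by (simp add: p1_def prod_decode_def prod_decode_aux.simps)

lemma center_eq: "center b i = real (center_num b i) / real (center_den b i)"
proof -
  have "min 1 (real p / real (Suc q)) = real (min p (Suc q)) / real (Suc q)" for p q
    by (auto simp: min_def)
  then show ?thesis
    unfolding center_def rat_center_def center_num_def center_den_def nth_code_eq Let_def
    by (auto simp: p1_def[symmetric] p2_def[symmetric] case_prod_unfold)
qed

lemma center_eq_0: "p1 b \<le> i \<Longrightarrow> center b i = 0"
  using length_list_decode_le[of "p1 b"] by (simp add: center_def rat_center_def)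

lemma radius_eq: "radius b = real (Suc (p1 (p2 b))) / real (Suc (p2 (p2 b)))"
  by (simp add: radius_def rat_radius_def p1_def p2_def split: prod.splits)

lemma radius_pos: "radius b > 0"
  unfolding radius_eq by simp

text \<open>Cross-multiplication yields inequalities between natural numbers; the absolute value
  becomes a disjunction, and moving terms to the other side avoids truncated subtraction.\<close>

lemma frac_abs_diff_ge_iff:
  fixes a a' v v' :: nat
  assumes "a > 0" "a' > 0" "v > 0" "v' > 0"
  shows "2 ^ i * (real u / real v + real u' / real v') \<le> \<bar>real n / real a - real n' / real a'\<bar> \<longleftrightarrow>
    n' * a * (v * v') + 2 ^ i * (u * v' + u' * v) * (a * a') \<le> n * a' * (v * v') \<or>
    n * a' * (v * v') + 2 ^ i * (u * v' + u' * v) * (a * a') \<le> n' * a * (v * v')"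
proof -
  have le: "X / (real v * real v') \<le> Z / (real a * real a') \<longleftrightarrow>
      X * (real a * real a') \<le> Z * (real v * real v')" for X Z
    using assms by (simp add: divide_simps)
  have 1: "2 ^ i * (real u / real v + real u' / real v') =
      2 ^ i * (real u * real v' + real u' * real v) / (real v * real v')"
    using assms by (simp add: add_frac_eq)
  have 2: "real n / real a - real n' / real a' = (real n * real a' - real n' * real a) / (real a * real a')"
    using assms by (simp add: diff_frac_eq)
  have 3: "\<bar>real n / real a - real n' / real a'\<bar> = \<bar>real n * real a' - real n' * real a\<bar> / (real a * real a')"
    unfolding 2 by (simp add: abs_mult)
  have 4: "\<bar>z\<bar> * c = max (z * c) (- z * c)" if "c \<ge> 0" for z c :: real
    using that by (auto simp: abs_if max_def mult_le_0_iff zero_le_mult_iff)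
  have 5: "k + l \<le> m \<longleftrightarrow> real l \<le> real m - real k" for k l m :: nat
    by linarith
  show ?thesis
    unfolding 1 3 le 5 using 4[of "real v * real v'"]
    by (simp add: le_max_iff_disj left_diff_distrib)
qed

text \<open>From coordinate \<open>p1 b + p1 b'\<close> on both centers vanish while the radii are
  positive, so the search for a separating coordinate is bounded.\<close>

lemma apart_iff:
  "apart b b' \<longleftrightarrow> (\<exists>i<p1 b + p1 b'.
    center_num b' i * center_den b i * (Suc (p2 (p2 b)) * Suc (p2 (p2 b'))) +
      2 ^ i * (Suc (p1 (p2 b)) * Suc (p2 (p2 b')) + Suc (p1 (p2 b')) * Suc (p2 (p2 b))) *
        (center_den b i * center_den b' i) \<le>
      center_num b i * center_den b' i * (Suc (p2 (p2 b)) * Suc (p2 (p2 b'))) \<or>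
    center_num b i * center_den b' i * (Suc (p2 (p2 b)) * Suc (p2 (p2 b'))) +
      2 ^ i * (Suc (p1 (p2 b)) * Suc (p2 (p2 b')) + Suc (p1 (p2 b')) * Suc (p2 (p2 b))) *
        (center_den b i * center_den b' i) \<le>
      center_num b' i * center_den b i * (Suc (p2 (p2 b)) * Suc (p2 (p2 b'))))"
  (is "_ \<longleftrightarrow> (\<exists>i<_. ?P i)")
proof -
  have P: "?P i \<longleftrightarrow> 2 ^ i * (radius b + radius b') \<le> \<bar>center b i - center b' i\<bar>" for i
    unfolding center_eq radius_eq
    by (rule frac_abs_diff_ge_iff[symmetric]) (simp_all add: center_den_def)
  have "i < p1 b + p1 b'" if "2 ^ i * (radius b + radius b') \<le> \<bar>center b i - center b' i\<bar>" for i
  proof (rule ccontr)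
    assume "\<not> i < p1 b + p1 b'"
    then have "center b i = 0" "center b' i = 0" by (simp_all add: center_eq_0)
    moreover have "0 < 2 ^ i * (radius b + radius b')"
      using radius_pos[of b] radius_pos[of b'] by simp
    ultimately show False using that by simp
  qed
  then show ?thesis
    unfolding P apart_def near_def by (auto simp: not_less)
qed

lemma decidable2_apart: "decidable2 apart"
  unfolding decidable2_def apart_iff
  by (intro decidable_ex_less decidable2_def[THEN iffD2] decidable_intros recursive_intros
      recursive_mult recursive_power recursive_min recursive_nth_code
      | simp only: center_num_def center_den_def)+

text \<open>A number \<open>i\<close> codes a list of labelled rational balls: \<open>p1 i\<close> is the index of the union of the
  balls in the numbering \<open>rat_open\<close>, and \<open>p2 i\<close> codes the list of labels (padded with zeros).\<close>

definition entries :: "nat \<Rightarrow> (nat \<times> nat) set" where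
  "entries i = (\<lambda>k. (nth_code (p1 i) k, nth_code (p2 i) k)) ` {k. k < length (list_decode (p1 i))}"

definition compatible :: "(nat \<times> nat) set \<Rightarrow> nat \<Rightarrow> nat \<Rightarrow> bool" where
  "compatible C i j \<longleftrightarrow>
    (\<forall>(b, y)\<in>entries i. \<forall>(b', y')\<in>entries j. apart b b' \<or> (y, y') \<in> C)"

lemma finite_entries: "finite (entries i)"
  by (simp add: entries_def)

lemma rat_open_eq: "rat_open (p1 i) = (\<Union>(b, y)\<in>entries i. rat_ball b)"
  by (auto simp: rat_open_def entries_def nth_code_eq set_conv_nth)

lemma entries_surj: "\<exists>i. entries i = set L"
proof
  have "set L = (\<lambda>k. L ! k) ` {k. k < length L}" by (auto simp: set_conv_nth)
  then show "entries (prod_encode (list_encode (map fst L), list_encode (map snd L))) = set L"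
    by (auto simp: entries_def nth_code_eq intro!: image_cong)
qed

text \<open>Pairs of labels are compared as single numbers, which turns \<open>C\<close> into a
  finite set of codes; positions in both lists are bounded by the list codes.\<close>

lemma decidable2_compatible:
  assumes "finite C"
  shows "decidable2 (compatible C)"
proof -
  have bnd: "(\<forall>k<n. drop_code n k \<noteq> 0 \<longrightarrow> P k) \<longleftrightarrow> (\<forall>k<length (list_decode n). P k)" for n P
    unfolding drop_code_eq_0_iff not_le using length_list_decode_le[of n] less_le_trans by blast
  have iff: "compatible C i j \<longleftrightarrow> (\<forall>k<p1 i. drop_code (p1 i) k \<noteq> 0 \<longrightarrow>
      (\<forall>l<p1 j. drop_code (p1 j) l \<noteq> 0 \<longrightarrow>
        apart (nth_code (p1 i) k) (nth_code (p1 j) l) \<or>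
        prod_encode (nth_code (p2 i) k, nth_code (p2 j) l) \<in> prod_encode ` C))" for i j
    unfolding bnd inj_image_mem_iff[OF inj_prod_encode] by (simp add: compatible_def entries_def)
  show ?thesis
    unfolding decidable2_def iff
    by (intro decidable_all_less decidable2_def[THEN iffD2] decidable_intros recursive_intros
        recursive_nth_code recursive_drop_code decidable2_comp[OF decidable2_apart]
        decidable_finite finite_imageI assms)
qed

text \<open>A number \<open>z\<close> codes the finite sequence of the first \<open>p2 z + 1\<close> entries of the list \<open>p1 z\<close>.\<close>

definition chain :: "(nat \<Rightarrow> bool) \<Rightarrow> (nat \<Rightarrow> nat \<Rightarrow> bool) \<Rightarrow> nat \<Rightarrow> bool" where
  "chain V K z \<longleftrightarrow> (\<forall>k<Suc (p2 z). V (nth_code (p1 z) k)) \<and>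
    (\<forall>k<p2 z. K (nth_code (p1 z) k) (nth_code (p1 z) (Suc k)))"

definition links :: "(nat \<Rightarrow> bool) \<Rightarrow> (nat \<Rightarrow> nat \<Rightarrow> bool) \<Rightarrow> (nat \<times> nat) set" where
  "links V K = {(i, j). V i \<and> V j \<and> K i j}"

lemma ex_nth_code: "\<exists>c. \<forall>k\<le>m. nth_code c k = g k"
  by (rule exI[of _ "list_encode (map g [0..<Suc m])"]) (auto simp: nth_code_eq nth_append)

text \<open>\<open>V\<close> and \<open>K\<close> will be decidable and belong to the certificate;
  \<open>Q\<close> stays outside because it becomes one oracle query per entry. The conditions on
  \<open>i\<close> on the right account for chains without links.\<close>

lemma chain_iff_links:
  "(\<exists>z. chain V K z \<and> nth_code (p1 z) 0 = i \<and> nth_code (p1 z) (p2 z) = j \<and>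
      (\<forall>k<Suc (p2 z). Q (nth_code (p1 z) k))) \<longleftrightarrow>
    V i \<and> Q i \<and> (i, j) \<in> (links (\<lambda>a. V a \<and> Q a) K)\<^sup>*"
proof
  assume "\<exists>z. chain V K z \<and> nth_code (p1 z) 0 = i \<and> nth_code (p1 z) (p2 z) = j \<and>
      (\<forall>k<Suc (p2 z). Q (nth_code (p1 z) k))"
  then obtain z where z: "chain V K z" "nth_code (p1 z) 0 = i" "nth_code (p1 z) (p2 z) = j"
    "\<forall>k<Suc (p2 z). Q (nth_code (p1 z) k)" by blast
  have "(nth_code (p1 z) 0, nth_code (p1 z) (p2 z)) \<in> (links (\<lambda>a. V a \<and> Q a) K) ^^ p2 z"
    unfolding relpow_fun_conv
    by (rule exI[of _ "nth_code (p1 z)"]) (use z in \<open>auto simp: chain_def links_def\<close>)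
  then show "V i \<and> Q i \<and> (i, j) \<in> (links (\<lambda>a. V a \<and> Q a) K)\<^sup>*"
    using z by (auto simp: chain_def intro: relpow_imp_rtrancl)
next
  assume *: "V i \<and> Q i \<and> (i, j) \<in> (links (\<lambda>a. V a \<and> Q a) K)\<^sup>*"
  then obtain m where "(i, j) \<in> (links (\<lambda>a. V a \<and> Q a) K) ^^ m"
    using rtrancl_imp_relpow by blast
  then obtain g where g: "g 0 = i" "g m = j" "\<And>k. k < m \<Longrightarrow> (g k, g (Suc k)) \<in> links (\<lambda>a. V a \<and> Q a) K"
    unfolding relpow_fun_conv by blast
  obtain c where c: "\<And>k. k \<le> m \<Longrightarrow> nth_code c k = g k"
    using ex_nth_code by blast
  have VQ: "V (g k) \<and> Q (g k)" if "k \<le> m" for k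
  proof (cases k)
    case 0
    then show ?thesis using * g(1) by simp
  next
    case (Suc l)
    then show ?thesis using g(3)[of l] that by (simp add: links_def)
  qed
  have "K (g k) (g (Suc k))" if "k < m" for k
    using g(3)[OF that] by (simp add: links_def)
  then show "\<exists>z. chain V K z \<and> nth_code (p1 z) 0 = i \<and> nth_code (p1 z) (p2 z) = j \<and>
      (\<forall>k<Suc (p2 z). Q (nth_code (p1 z) k))"
    using VQ c g by (intro exI[of _ "prod_encode (c, m)"]) (simp add: chain_def)
qed

text \<open>Every query also sees the first entry of the chain; for pairs this lets a question about
  \<open>A\<close> carry one about \<open>X\<close>. The predicate \<open>out\<close> selects which
  ends of the chain are enumerated.\<close>

lemma enum_reducible_chain:
  assumes V: "decidable V" and K: "decidable2 K" and q: "recursive2 q" and out: "decidable2 out"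
  shows "enum_reducible {n. \<exists>z. (out n z \<and> chain V K z) \<and>
    (\<forall>k<Suc (p2 z). q (nth_code (p1 z) 0) (nth_code (p1 z) k) \<in> B)} B"
proof (rule enum_reducible_queries)
  show "decidable2 (\<lambda>n z. out n z \<and> chain V K z)"
    unfolding decidable2_def chain_def
    by (intro decidable_conj decidable_all_less decidable2_def[THEN iffD2] decidable_comp[OF V]
        decidable2_comp[OF K] decidable2_comp[OF out] recursive_intros recursive_nth_code)
  show "recursive2 (\<lambda>n z. Suc (p2 z))"
    unfolding recursive2_def by (intro recursive_intros)
  show "recursive3 (\<lambda>n z k. q (nth_code (p1 z) 0) (nth_code (p1 z) k))"
    unfolding recursive3_def by (intro recursive2_comp[OF q] recursive_intros recursive_nth_code)
qed

lemma enum_reducible_links: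
  assumes V: "decidable V" and K: "decidable2 K" and q: "recursive2 q"
  shows "enum_reducible (prod_encode ` {(i, j). V i \<and> q i i \<in> B \<and>
      (i, j) \<in> (links (\<lambda>a. V a \<and> q i a \<in> B) K)\<^sup>*}) B" (is "enum_reducible ?R B")
    and "enum_reducible {j. \<exists>i. V i \<and> q i i \<in> B \<and> (i, j) \<in> (links (\<lambda>a. V a \<and> q i a \<in> B) K)\<^sup>*} B"
      (is "enum_reducible ?S B")
proof -
  have eq: "(\<exists>z. chain V K z \<and> nth_code (p1 z) 0 = i \<and> nth_code (p1 z) (p2 z) = j \<and>
      (\<forall>k<Suc (p2 z). q i (nth_code (p1 z) k) \<in> B)) \<longleftrightarrow>
    V i \<and> q i i \<in> B \<and> (i, j) \<in> (links (\<lambda>a. V a \<and> q i a \<in> B) K)\<^sup>*" for i j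
    using chain_iff_links[of V K i j "\<lambda>a. q i a \<in> B"] .
  have R: "?R = {n. \<exists>z. (n = prod_encode (nth_code (p1 z) 0, nth_code (p1 z) (p2 z)) \<and> chain V K z) \<and>
      (\<forall>k<Suc (p2 z). q (nth_code (p1 z) 0) (nth_code (p1 z) k) \<in> B)}"
    unfolding eq[symmetric] by (intro set_eqI) (simp add: image_iff; blast)
  show "enum_reducible ?R B"
    unfolding R by (rule enum_reducible_chain[OF V K q])
      (unfold decidable2_def, intro decidable_eq recursive_intros recursive_nth_code)
  have S: "?S = {n. \<exists>z. (n = nth_code (p1 z) (p2 z) \<and> chain V K z) \<and>
      (\<forall>k<Suc (p2 z). q (nth_code (p1 z) 0) (nth_code (p1 z) k) \<in> B)}"
    unfolding eq[symmetric] by blast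
  show "enum_reducible ?S B"
    unfolding S by (rule enum_reducible_chain[OF V K q])
      (unfold decidable2_def, intro decidable_eq recursive_intros recursive_nth_code)
qed

lemma enum_reducible_query:
  assumes V: "decidable V" and q: "recursive q"
  shows "enum_reducible {i. V i \<and> q i \<in> B} B"
proof -
  have eq: "{i. V i \<and> q i \<in> B} = {i. \<exists>c. V i \<and> (\<forall>k<Suc 0. q i \<in> B)}" by auto
  show ?thesis
    by (subst eq, rule enum_reducible_queries; unfold decidable2_def recursive2_def recursive3_def;
      intro decidable_comp[OF V] recursive_comp[OF q] recursive_intros)
qed


section \<open>Uniform estimates on compact sets\<close>

lemma near_commute: "near d u v \<longleftrightarrow> near d v u"
  by (simp add: near_def abs_minus_commute)

lemma near_refl: "d > 0 \<Longrightarrow> near d u u"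
  by (simp add: near_def)

lemma near_mono: "near d u v \<Longrightarrow> d \<le> d' \<Longrightarrow> near d' u v"
  unfolding near_def by (meson less_le_trans mult_left_mono zero_le_numeral zero_le_power)

lemma near_triangle:
  assumes "near a u v" "near b v w"
  shows "near (a + b) u w"
  unfolding near_def
proof
  fix i
  have "\<bar>u i - w i\<bar> \<le> \<bar>u i - v i\<bar> + \<bar>v i - w i\<bar>" by simp
  also have "\<dots> < 2 ^ i * a + 2 ^ i * b"
    using assms by (intro add_strict_mono) (simp_all add: near_def)
  finally show "\<bar>u i - w i\<bar> < 2 ^ i * (a + b)" by (simp add: distrib_left)
qed

lemma near_imp_near_le: "near d u v \<Longrightarrow> near_le d u v"
  by (simp add: near_def near_le_def less_imp_le)

lemma near_le_imp_near:
  assumes "near_le a u v" "a < b"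
  shows "near b u v"
  unfolding near_def
proof
  fix i
  have "\<bar>u i - v i\<bar> \<le> 2 ^ i * a" using assms(1) by (simp add: near_le_def)
  also have "\<dots> < 2 ^ i * b" using assms(2) by simp
  finally show "\<bar>u i - v i\<bar> < 2 ^ i * b" .
qed

lemma near_le_near_triangle:
  assumes "near_le a u v" "near b v w"
  shows "near (a + b) u w"
  unfolding near_def
proof
  fix i
  have "\<bar>u i - w i\<bar> \<le> \<bar>u i - v i\<bar> + \<bar>v i - w i\<bar>" by simp
  also have "\<dots> < 2 ^ i * a + 2 ^ i * b"
    using assms by (intro add_le_less_mono) (simp_all add: near_def near_le_def)
  finally show "\<bar>u i - w i\<bar> < 2 ^ i * (a + b)" by (simp add: distrib_left)
qed

text \<open>Coordinatewise this is convexity of an open interval; the estimate stays strict because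
  at least one weight is positive.\<close>

lemma near_convex:
  assumes E: "finite E" "\<And>e. e \<in> E \<Longrightarrow> 0 \<le> w e" "0 < sum w E"
    and near: "\<And>e. e \<in> E \<Longrightarrow> 0 < w e \<Longrightarrow> near d u (t e)"
  shows "near d u (\<lambda>n. (\<Sum>e\<in>E. w e * t e n) / sum w E)"
  unfolding near_def
proof
  fix n
  have le: "w e * \<bar>u n - t e n\<bar> \<le> w e * (2 ^ n * d)" if "e \<in> E" for e
    using near[OF that] E(2)[OF that] unfolding near_def
    by (cases "w e = 0") (auto intro!: mult_left_mono simp: less_imp_le)
  obtain e where e: "e \<in> E" "0 < w e"
    using E(3) by (metis not_less sum_nonpos)
  have "u n - (\<Sum>e\<in>E. w e * t e n) / sum w E = (\<Sum>e\<in>E. w e * (u n - t e n)) / sum w E"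
    using E(3) by (simp add: field_simps sum_subtractf sum_distrib_left)
  then have "\<bar>u n - (\<Sum>e\<in>E. w e * t e n) / sum w E\<bar> = \<bar>\<Sum>e\<in>E. w e * (u n - t e n)\<bar> / sum w E"
    using E(3) by simp
  also have "\<dots> \<le> (\<Sum>e\<in>E. w e * \<bar>u n - t e n\<bar>) / sum w E"
    using E sum_abs[of "\<lambda>e. w e * (u n - t e n)" E] by (simp add: abs_mult divide_right_mono)
  also have "\<dots> < (\<Sum>e\<in>E. w e * (2 ^ n * d)) / sum w E"
  proof (rule divide_strict_right_mono[OF sum_strict_mono_ex1[OF E(1)] E(3)])
    show "\<exists>a\<in>E. w a * \<bar>u n - t a n\<bar> < w a * (2 ^ n * d)"
      using near[OF e] e unfolding near_def by (intro bexI[of _ e]) auto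
  qed (use le in auto)
  also have "\<dots> = 2 ^ n * d"
    using E(3) by (simp add: sum_distrib_right[symmetric])
  finally show "\<bar>u n - (\<Sum>e\<in>E. w e * t e n) / sum w E\<bar> < 2 ^ n * d" .
qed

text \<open>Differences in the cube are at most 1, so coordinates with \<open>2 ^ i * d\<close>
  above 1 impose nothing. This makes \<open>near d\<close> an open condition on the cube.\<close>

lemma near_eq_finite:
  assumes "0 < d"
  shows "\<exists>n. \<forall>u\<in>hilbert_cube. \<forall>v\<in>hilbert_cube. near d u v \<longleftrightarrow> (\<forall>i<n. \<bar>u i - v i\<bar> < 2 ^ i * d)"
proof -
  obtain n where n: "1 / d < 2 ^ n" using real_arch_pow[of 2 "1 / d"] by auto
  have "\<bar>u i - v i\<bar> < 2 ^ i * d" if "n \<le> i" "u \<in> hilbert_cube" "v \<in> hilbert_cube" for u v i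
  proof -
    have "\<bar>u i - v i\<bar> \<le> 1"
      using that(2,3) unfolding hilbert_cube_def by (smt (verit) mem_Collect_eq)
    also have "1 < 2 ^ n * d" using n assms by (simp add: field_simps)
    also have "\<dots> \<le> 2 ^ i * d" using that(1) assms by simp
    finally show ?thesis .
  qed
  then show ?thesis unfolding near_def by (intro exI[of _ n]) (meson not_less)
qed

lemma continuous_on_coordinate_abs_diff:
  fixes F G :: "'z::topological_space \<Rightarrow> nat \<Rightarrow> real"
  assumes "continuous_on Z F" "continuous_on Z G"
  shows "continuous_on Z (\<lambda>z. \<bar>F z i - G z i\<bar>)"
  by (intro continuous_intros assms[THEN continuous_on_product_then_coordinatewise])

lemma compact_not_near:
  fixes F G :: "'z::topological_space \<Rightarrow> nat \<Rightarrow> real"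
  assumes Z: "compact Z" and cont: "continuous_on Z F" "continuous_on Z G"
    and cube: "F ` Z \<subseteq> hilbert_cube" "G ` Z \<subseteq> hilbert_cube" and d: "0 < d"
  shows "compact {z \<in> Z. \<not> near d (F z) (G z)}"
proof -
  obtain n where n: "\<And>z. z \<in> Z \<Longrightarrow> near d (F z) (G z) \<longleftrightarrow> (\<forall>i<n. \<bar>F z i - G z i\<bar> < 2 ^ i * d)"
    using near_eq_finite[OF d] cube by (metis image_subset_iff)
  have "{z \<in> Z. \<not> near d (F z) (G z)} = (\<Union>i<n. Z \<inter> (\<lambda>z. \<bar>F z i - G z i\<bar>) -` {2 ^ i * d..})"
    unfolding set_eq_iff using n by (auto simp: not_less[symmetric])
  moreover have "compact (Z \<inter> (\<lambda>z. \<bar>F z i - G z i\<bar>) -` {2 ^ i * d..})" for i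
    by (intro closedin_compact[OF Z] continuous_closedin_preimage
        continuous_on_coordinate_abs_diff cont closed_atLeast)
  ultimately show ?thesis by (simp only:) (intro compact_UN; simp)
qed

text \<open>Every point violates \<open>near_le r\<close> with some margin
  \<open>1 / real (Suc n)\<close>. For each margin the violating points form an open set; a margin
  below those of a finite subcover serves all of \<open>Z\<close>.\<close>

lemma compact_separation:
  fixes F G :: "'z::topological_space \<Rightarrow> nat \<Rightarrow> real"
  assumes Z: "compact Z" and cont: "continuous_on Z F" "continuous_on Z G"
    and sep: "\<And>z. z \<in> Z \<Longrightarrow> \<not> near_le r (F z) (G z)"
  shows "\<exists>\<sigma>>0. \<forall>z\<in>Z. \<not> near (r + \<sigma>) (F z) (G z)"
proof -
  define P where "P n i = Z \<inter> (\<lambda>z. \<bar>F z i - G z i\<bar>) -` {2 ^ i * (r + 1 / real (Suc n))<..}" for n i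
  have op: "openin (top_of_set Z) (\<Union>i. P n i)" for n
    unfolding P_def
    by (intro openin_Union ballI; clarsimp)
      (intro continuous_openin_preimage_gen continuous_on_coordinate_abs_diff cont open_greaterThan)
  have cov: "Z \<subseteq> (\<Union>n. \<Union>i. P n i)"
  proof
    fix z assume z: "z \<in> Z"
    then obtain i where i: "2 ^ i * r < \<bar>F z i - G z i\<bar>"
      using sep unfolding near_le_def by (meson not_le)
    then have "0 < \<bar>F z i - G z i\<bar> / 2 ^ i - r" by (simp add: field_simps)
    then obtain n where "1 / real (Suc n) < \<bar>F z i - G z i\<bar> / 2 ^ i - r"
      using nat_approx_posE by (metis of_nat_Suc)
    then have "r + 1 / real (Suc n) < \<bar>F z i - G z i\<bar> / 2 ^ i" by linarith
    then have "2 ^ i * (r + 1 / real (Suc n)) < \<bar>F z i - G z i\<bar>"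
      by (simp add: less_divide_eq mult.commute)
    then show "z \<in> (\<Union>n. \<Union>i. P n i)" using z by (auto simp: P_def)
  qed
  obtain D where D: "D \<subseteq> range (\<lambda>n. \<Union>i. P n i)" "finite D" "Z \<subseteq> \<Union>D"
    using Z[unfolded compact_eq_openin_cover, rule_format, of "range (\<lambda>n. \<Union>i. P n i)"] op cov
    by auto
  then obtain J where J: "finite J" "D = (\<lambda>n. \<Union>i. P n i) ` J"
    using finite_subset_image by metis
  obtain N where N: "\<And>n. n \<in> J \<Longrightarrow> n \<le> N"
    using J(1) finite_nat_set_iff_bounded_le by auto
  have "\<not> near (r + 1 / real (Suc N)) (F z) (G z)" if z: "z \<in> Z" for z
  proof -
    obtain n i where "n \<in> J" "2 ^ i * (r + 1 / real (Suc n)) < \<bar>F z i - G z i\<bar>"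
      using z D(3) J(2) by (auto simp: P_def)
    moreover have "1 / real (Suc N) \<le> 1 / real (Suc n)"
      using N[OF \<open>n \<in> J\<close>] by (simp add: frac_le)
    then have "2 ^ i * (r + 1 / real (Suc N)) \<le> 2 ^ i * (r + 1 / real (Suc n))" by simp
    ultimately show ?thesis unfolding near_def by (meson le_less_trans less_asym)
  qed
  then show ?thesis by (intro exI[of _ "1 / real (Suc N)"]) auto
qed

lemma near_le_0_iff: "near_le 0 u v \<longleftrightarrow> u = v"
  by (auto simp: near_le_def)

text \<open>The points where \<open>F'\<close> and \<open>G'\<close> are not \<open>d\<close>-near
  form a compact set on which \<open>F\<close> and \<open>G\<close> never agree, so
  \<open>compact_separation\<close> with \<open>r = 0\<close> applies. Uniform continuity and the
  control of the retraction near \<open>S\<close> are special cases.\<close>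

lemma compact_uniform_near:
  fixes F G F' G' :: "'z::topological_space \<Rightarrow> nat \<Rightarrow> real"
  assumes Z: "compact Z" and cont: "continuous_on Z F" "continuous_on Z G"
    and cont': "continuous_on Z F'" "continuous_on Z G'"
    and cube: "F' ` Z \<subseteq> hilbert_cube" "G' ` Z \<subseteq> hilbert_cube"
    and eq: "\<And>z. z \<in> Z \<Longrightarrow> F z = G z \<Longrightarrow> F' z = G' z" and d: "0 < d"
  shows "\<exists>\<sigma>>0. \<forall>z\<in>Z. near \<sigma> (F z) (G z) \<longrightarrow> near d (F' z) (G' z)"
proof -
  have "\<exists>\<sigma>>0. \<forall>z\<in>{z \<in> Z. \<not> near d (F' z) (G' z)}. \<not> near (0 + \<sigma>) (F z) (G z)"
  proof (rule compact_separation)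
    show "compact {z \<in> Z. \<not> near d (F' z) (G' z)}" by (rule compact_not_near[OF Z cont' cube d])
  qed (use cont eq d in \<open>auto simp: near_le_0_iff near_refl intro: continuous_on_subset\<close>)
  then show ?thesis by auto
qed

lemma near_uniform_continuity:
  assumes "compact X" "continuous_on X f" "f ` X \<subseteq> hilbert_cube" "0 < d"
  shows "\<exists>\<sigma>>0. \<forall>x\<in>X. \<forall>x'\<in>X. near \<sigma> x x' \<longrightarrow> near d (f x) (f x')"
proof -
  have "\<exists>\<sigma>>0. \<forall>z\<in>X \<times> X. near \<sigma> (fst z) (snd z) \<longrightarrow> near d (f (fst z)) (f (snd z))"
  proof (rule compact_uniform_near)
    show fst: "continuous_on (X \<times> X) fst" and snd: "continuous_on (X \<times> X) snd"
      by (rule continuous_on_fst[OF continuous_on_id], rule continuous_on_snd[OF continuous_on_id])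
    show "continuous_on (X \<times> X) (\<lambda>z. f (fst z))" "continuous_on (X \<times> X) (\<lambda>z. f (snd z))"
      by (rule continuous_on_compose2[OF assms(2) fst], force)
        (rule continuous_on_compose2[OF assms(2) snd], force)
  qed (use assms in \<open>auto intro!: compact_Times\<close>)
  then show ?thesis by auto
qed

text \<open>Time is inserted as an additional coordinate in front, so that \<open>near\<close>
  measures time and space together. Shifting the space coordinates by one place only relaxes their
  bounds.\<close>

lemma near_homotopy:
  fixes h :: "real \<times> (nat \<Rightarrow> real) \<Rightarrow> nat \<Rightarrow> real"
  assumes X: "compact X" and h: "continuous_on ({0..1} \<times> X) h" "h ` ({0..1} \<times> X) \<subseteq> hilbert_cube"
    and d: "0 < d"
  shows "\<exists>\<sigma>>0. \<forall>t\<in>{0..1}. \<forall>t'\<in>{0..1}. \<forall>x\<in>X. \<forall>x'\<in>X.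
    \<bar>t - t'\<bar> < \<sigma> \<longrightarrow> near \<sigma> x x' \<longrightarrow> near d (h (t, x)) (h (t', x'))"
proof -
  define J where "J p = (\<lambda>n. case n of 0 \<Rightarrow> fst p | Suc m \<Rightarrow> snd p m)" for p :: "real \<times> (nat \<Rightarrow> real)"
  have J: "continuous_on A J" for A
    unfolding J_def
  proof (rule continuous_on_coordinatewise_then_product)
    show "continuous_on A (\<lambda>p::real \<times> (nat \<Rightarrow> real). case i of 0 \<Rightarrow> fst p | Suc m \<Rightarrow> snd p m)" for i
      using continuous_on_fst[OF continuous_on_id]
        continuous_on_product_then_coordinatewise[OF continuous_on_snd[OF continuous_on_id]]
      by (cases i) simp_all
  qed
  have inj: "p = q" if "J p = J q" for p q
    using fun_cong[OF that, of 0] fun_cong[OF that, of "Suc _"] by (auto simp: J_def prod_eq_iff)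
  have "\<exists>\<sigma>>0. \<forall>z\<in>({0..1} \<times> X) \<times> ({0..1} \<times> X).
      near \<sigma> (J (fst z)) (J (snd z)) \<longrightarrow> near d (h (fst z)) (h (snd z))"
  proof (rule compact_uniform_near)
    let ?Z = "({0..1::real} \<times> X) \<times> {0..1::real} \<times> X"
    have fst: "continuous_on ?Z fst" and snd: "continuous_on ?Z snd"
      by (rule continuous_on_fst[OF continuous_on_id], rule continuous_on_snd[OF continuous_on_id])
    show "compact ?Z" by (intro compact_Times compact_Icc X)
    show "continuous_on ?Z (\<lambda>z. J (fst z))" "continuous_on ?Z (\<lambda>z. J (snd z))"
      by (rule continuous_on_compose2[OF J[of UNIV] fst], simp)
        (rule continuous_on_compose2[OF J[of UNIV] snd], simp)
    show "continuous_on ?Z (\<lambda>z. h (fst z))" "continuous_on ?Z (\<lambda>z. h (snd z))"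
      by (rule continuous_on_compose2[OF h(1) fst], force)
        (rule continuous_on_compose2[OF h(1) snd], force)
    show "h (fst z) = h (snd z)" if "J (fst z) = J (snd z)" for z
      using inj[OF that] by simp
  qed (use h(2) d in \<open>auto simp: image_subset_iff\<close>)
  then obtain \<sigma> where \<sigma>: "0 < \<sigma>" "\<And>z. z \<in> ({0..1} \<times> X) \<times> ({0..1} \<times> X) \<Longrightarrow>
      near \<sigma> (J (fst z)) (J (snd z)) \<Longrightarrow> near d (h (fst z)) (h (snd z))" by blast
  have "near d (h (t, x)) (h (t', x'))"
    if "t \<in> {0..1}" "t' \<in> {0..1}" "x \<in> X" "x' \<in> X" "\<bar>t - t'\<bar> < \<sigma>" "near \<sigma> x x'" for t t' x x'
  proof -
    have "near \<sigma> (J (t, x)) (J (t', x'))"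
      unfolding near_def
    proof
      fix i
      show "\<bar>J (t, x) i - J (t', x') i\<bar> < 2 ^ i * \<sigma>"
      proof (cases i)
        case 0
        then show ?thesis using that(5) by (simp add: J_def)
      next
        case (Suc m)
        have "\<bar>x m - x' m\<bar> < 2 ^ m * \<sigma>" using that(6) by (simp add: near_def)
        also have "\<dots> \<le> 2 ^ Suc m * \<sigma>" using \<sigma>(1) by simp
        finally show ?thesis by (simp add: Suc J_def)
      qed
    qed
    then show ?thesis using \<sigma>(2)[of "((t, x), (t', x'))"] that by simp
  qed
  then show ?thesis using \<sigma>(1) by blast
qed

text \<open>The points of \<open>X\<close> violating the conclusion form a compact set outside the
  closed box and are therefore separated from it.\<close>

lemma near_gap:
  assumes X: "compact X" and f: "continuous_on X f" "f ` X \<subseteq> hilbert_cube" and s: "s \<in> hilbert_cube"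
    and d: "0 < d" and near: "\<And>x. x \<in> X \<Longrightarrow> near_le r c x \<Longrightarrow> near d s (f x)"
  shows "\<exists>\<sigma>>0. \<forall>x\<in>X. near (r + \<sigma>) c x \<longrightarrow> near d s (f x)"
proof -
  have "\<exists>\<sigma>>0. \<forall>x\<in>{x \<in> X. \<not> near d s (f x)}. \<not> near (r + \<sigma>) c x"
  proof (rule compact_separation)
    show "compact {x \<in> X. \<not> near d s (f x)}"
      by (rule compact_not_near) (use assms in auto)
  qed (use near in auto)
  then show ?thesis by blast
qed

text \<open>A weighted coordinate difference is a single term of the series
  \<open>hc_dist\<close>.\<close>

lemma near_of_hc_dist:
  assumes "c \<in> hilbert_cube" "x \<in> hilbert_cube" "hc_dist c x < r"
  shows "near r c x"
  unfolding near_def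
proof
  fix i
  have "(\<Sum>n\<in>{i}. (1/2)^n * \<bar>c n - x n\<bar>) \<le> hc_dist c x"
    unfolding hc_dist_def by (intro sum_le_suminf hc_dist_summable assms(1,2)) auto
  then have "(1/2)^i * \<bar>c i - x i\<bar> < r" using assms(3) by simp
  then show "\<bar>c i - x i\<bar> < 2 ^ i * r" by (simp add: power_divide divide_less_eq mult.commute)
qed

lemma center_in_cube: "center b \<in> hilbert_cube"
proof -
  have "real (center_num b i) \<le> real (center_den b i)" for i
    unfolding of_nat_le_iff center_num_def center_den_def by (rule min.cobounded2)
  then show ?thesis
    unfolding hilbert_cube_def center_eq by (simp add: divide_le_eq)
qed

lemma rat_ball_near: "x \<in> rat_ball b \<Longrightarrow> near (radius b) (center b) x"
  unfolding rat_ball_eq hc_ball_def using near_of_hc_dist[OF center_in_cube] by auto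

lemma continuous_on_hc_dist:
  assumes c: "c \<in> hilbert_cube"
  shows "continuous_on hilbert_cube (hc_dist c)"
proof (rule uniform_limit_theorem)
  show "uniform_limit hilbert_cube (\<lambda>n x. \<Sum>i<n. (1/2)^i * \<bar>c i - x i\<bar>) (hc_dist c) sequentially"
    unfolding hc_dist_def
  proof (rule Weierstrass_m_test)
    show "norm ((1/2)^n * \<bar>c n - x n\<bar>) \<le> (1/2)^n" if "x \<in> hilbert_cube" for n x
    proof -
      have "\<bar>c n - x n\<bar> \<le> 1"
        using c that unfolding hilbert_cube_def by (smt (verit) mem_Collect_eq)
      then show ?thesis by (simp add: abs_mult)
    qed
  qed (simp add: summable_geometric)
  show "\<forall>\<^sub>F n in sequentially. continuous_on hilbert_cube (\<lambda>x. \<Sum>i<n. (1/2)^i * \<bar>c i - x i\<bar>)"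
    by (intro always_eventually allI continuous_intros
      continuous_on_subset[OF continuous_on_product_coordinates subset_UNIV])
qed simp

lemma openin_rat_ball: "openin (top_of_set hilbert_cube) (rat_ball b)"
proof -
  have "rat_ball b = hilbert_cube \<inter> hc_dist (center b) -` {..<radius b}"
    by (auto simp: rat_ball_eq hc_ball_def)
  then show ?thesis
    using continuous_openin_preimage_gen[OF continuous_on_hc_dist[OF center_in_cube] open_lessThan]
    by simp
qed

text \<open>A converse to \<open>near_of_hc_dist\<close> at a fixed point: the points at distance at
  least \<open>q\<close> from \<open>x\<close> form a compact set that avoids
  \<open>x\<close>.\<close>

lemma near_imp_hc_dist_less:
  assumes x: "x \<in> hilbert_cube" and q: "0 < q"
  shows "\<exists>\<sigma>>0. \<forall>c\<in>hilbert_cube. near \<sigma> x c \<longrightarrow> hc_dist x c < q"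
proof -
  have "compact (hilbert_cube \<inter> hc_dist x -` {q..})"
    by (intro closedin_compact[OF compact_hilbert_cube] continuous_closedin_preimage
        continuous_on_hc_dist x closed_atLeast)
  moreover have "\<not> near_le 0 x c" if "c \<in> hilbert_cube \<inter> hc_dist x -` {q..}" for c
    using that q by (auto simp: near_le_0_iff hc_dist_def)
  ultimately have "\<exists>\<sigma>>0. \<forall>c\<in>hilbert_cube \<inter> hc_dist x -` {q..}. \<not> near (0 + \<sigma>) x c"
    by (intro compact_separation) auto
  then obtain \<sigma> where \<sigma>: "0 < \<sigma>" "\<And>c. c \<in> hilbert_cube \<inter> hc_dist x -` {q..} \<Longrightarrow> \<not> near \<sigma> x c"
    by auto
  have "hc_dist x c < q" if "c \<in> hilbert_cube" "near \<sigma> x c" for c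
  proof (rule ccontr)
    assume "\<not> hc_dist x c < q"
    then show False using \<sigma>(2)[of c] that by auto
  qed
  then show ?thesis using \<sigma>(1) by blast
qed

lemma ex_near_rat_center:
  assumes x: "x \<in> hilbert_cube" and \<sigma>: "0 < \<sigma>"
  shows "\<exists>c. near \<sigma> x (rat_center c)"
proof -
  obtain n where n: "1 / real (Suc n) < \<sigma>" using nat_approx_posE[OF \<sigma>] by metis
  \<comment> \<open>The first \<open>n\<close> coordinates are rounded down to multiples of
    \<open>1 / real (Suc n)\<close>, the others replaced by 0. From index \<open>n\<close> on an
    error of 1 is harmless: \<open>2 ^ i\<close> is at least \<open>Suc n\<close>, and
    \<open>real (Suc n) * \<sigma>\<close> exceeds 1.\<close>
  define c where "c = list_encode (map (\<lambda>i. prod_encode (nat \<lfloor>real (Suc n) * x i\<rfloor>, n)) [0..<n])"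
  have x01: "0 \<le> x i" "x i \<le> 1" for i using x by (auto simp: hilbert_cube_def)
  have "\<bar>x i - rat_center c i\<bar> < 2 ^ i * \<sigma>" for i
  proof (cases "i < n")
    case True
    define m where "m = nat \<lfloor>real (Suc n) * x i\<rfloor>"
    have nn: "0 \<le> real (Suc n) * x i" using x01[of i] by simp
    have m: "real m \<le> real (Suc n) * x i" "real (Suc n) * x i < real m + 1"
      unfolding m_def using nn by linarith+
    have "real m \<le> real (Suc n)"
    proof -
      have "real (Suc n) * x i \<le> real (Suc n) * 1" by (intro mult_left_mono x01) simp
      then show ?thesis using order_trans[OF m(1)] by simp
    qed
    then have "real m / real (Suc n) \<le> 1" by simp
    then have c: "rat_center c i = real m / real (Suc n)"
      using True by (simp add: rat_center_def c_def m_def)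
    have "rat_center c i \<le> x i" "x i < rat_center c i + 1 / real (Suc n)"
      unfolding c using m by (simp_all add: divide_simps mult.commute)
    then have "\<bar>x i - rat_center c i\<bar> < \<sigma>" using n by linarith
    also have "\<sigma> \<le> 2 ^ i * \<sigma>" using \<sigma> by simp
    finally show ?thesis .
  next
    case False
    then have "\<bar>x i - rat_center c i\<bar> \<le> 1" using x01[of i] by (simp add: rat_center_def c_def)
    also have "1 < real (Suc n) * \<sigma>" using n by (simp add: divide_less_eq mult.commute)
    also have "\<dots> \<le> 2 ^ i * \<sigma>"
    proof (rule mult_right_mono)
      have "Suc n \<le> 2 ^ n" by (simp add: Suc_leI less_exp)
      then have "Suc n \<le> 2 ^ i" using False power_increasing[of n i "2::nat"] by linarith
      then show "real (Suc n) \<le> 2 ^ i" by (metis of_nat_le_iff of_nat_numeral of_nat_power)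
    qed (use \<sigma> in simp)
    finally show ?thesis .
  qed
  then show ?thesis unfolding near_def by blast
qed

lemma ex_small_rat_ball:
  assumes x: "x \<in> hilbert_cube" and \<sigma>: "0 < \<sigma>"
  shows "\<exists>b. x \<in> rat_ball b \<and> radius b < \<sigma>"
proof -
  obtain k where k: "1 / real (Suc k) < \<sigma>" using nat_approx_posE[OF \<sigma>] by metis
  obtain \<delta> where \<delta>: "0 < \<delta>" "\<And>c. c \<in> hilbert_cube \<Longrightarrow> near \<delta> x c \<Longrightarrow> hc_dist x c < 1 / real (Suc k)"
    using near_imp_hc_dist_less[OF x, of "1 / real (Suc k)"] by auto
  obtain c where c: "near \<delta> x (rat_center c)" using ex_near_rat_center[OF x \<delta>(1)] by blast
  define b where "b = prod_encode (c, prod_encode (0, k))"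
  have b: "center b = rat_center c" "radius b = 1 / real (Suc k)"
    by (simp_all add: b_def center_def radius_def rat_radius_def)
  have "hc_dist (center b) x < radius b"
    using \<delta>(2)[OF center_in_cube[of b]] c b by (simp add: hc_dist_def abs_minus_commute)
  then show ?thesis using x k b by (intro exI[of _ b]) (simp add: rat_ball_eq hc_ball_def)
qed


section \<open>Neighborhood retracts of the Hilbert cube\<close>

text \<open>The coordinates are distances to a dense sequence, cut off at 1; the sequence enumerates
  the union of finite nets of radius \<open>1 / real (Suc n)\<close>. The empty space has no such
  sequence and is treated apart.\<close>

lemma compact_metrizable_embeds:
  assumes Y: "compact_space Y" "metrizable_space Y"
  shows "\<exists>S e e'. S \<subseteq> hilbert_cube \<and> homeomorphic_maps Y (top_of_set S) e e'"
proof (cases "topspace Y = {}")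
  case True
  then have "homeomorphic_maps Y (top_of_set ({} :: (nat \<Rightarrow> real) set)) undefined undefined"
    by (simp add: homeomorphic_maps_def continuous_map_def)
  then show ?thesis by blast
next
  case False
  obtain M d where "Metric_space M d" and Y_eq: "Y = Metric_space.mtopology M d"
    using Y(2) unfolding metrizable_space_def by blast
  then interpret Metric_space M d by simp
  have M: "topspace Y = M" by (simp add: Y_eq)
  have "mtotally_bounded M"
    using Y(1) compactin_imp_mtotally_bounded[of M] unfolding Y_eq compact_space_def by simp
  then have "\<exists>K. finite K \<and> K \<subseteq> M \<and> M \<subseteq> (\<Union>x\<in>K. mball x (1 / real (Suc n)))" for n
    unfolding mtotally_bounded_def by simp
  then obtain K where K: "\<And>n. finite (K n)" "\<And>n. K n \<subseteq> M"
    "\<And>n. M \<subseteq> (\<Union>x\<in>K n. mball x (1 / real (Suc n)))" by metis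
  define D where "D = (\<Union>n. K n)"
  have D: "countable D" "D \<subseteq> M" "D \<noteq> {}"
    using K False M by (auto simp: D_def countable_finite)
  define a where "a = from_nat_into D"
  have a: "range a = D" using D by (simp add: a_def)
  then have aM: "a n \<in> M" for n using D(2) by blast
  define e where "e y = (\<lambda>n. min 1 (d y (a n)))" for y
  have "continuous_map mtopology euclideanreal (\<lambda>y. d y (a n))" for n
    using continuous_map_mdist[of mtopology Self "\<lambda>y. y" "\<lambda>_. a n"] aM by (simp add: mtopology_of_def)
  then have "continuous_map mtopology euclideanreal (\<lambda>y. e y n)" for n
    unfolding e_def by (intro continuous_map_real_min) auto
  then have cont: "continuous_map Y euclidean e"
    unfolding Y_eq euclidean_product_topology[symmetric] continuous_map_componentwise_UNIV by simp
  have inj: "inj_on e (topspace Y)"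
  proof (rule inj_onI, rule ccontr)
    fix y z assume yz: "y \<in> topspace Y" "z \<in> topspace Y" "e y = e z" "y \<noteq> z"
    then have yM: "y \<in> M" "z \<in> M" "0 < d y z" using M by auto
    \<comment> \<open>The bound 1 keeps the distance from \<open>y\<close> to the net point below
      the cutoff; half of \<open>d y z\<close> makes that point strictly closer to \<open>y\<close>
      than to \<open>z\<close>.\<close>
    then have "0 < min 1 (d y z / 2)" by simp
    from nat_approx_posE[OF this] obtain n where n: "1 / real (Suc n) < min 1 (d y z / 2)" .
    obtain x where x: "x \<in> K n" "d x y < 1 / real (Suc n)"
      using K(3)[of n] yM(1) by auto
    then have "x \<in> range a" unfolding a D_def by blast
    then obtain k where k: "a k = x" by blast
    have "d y z \<le> d y x + d x z" using triangle yM K(2) x(1) by blast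
    moreover have "d y x < 1" "d y x < d y z / 2"
      using less_trans[OF x(2) n] commute[of x y] by simp_all
    ultimately have "min 1 (d y x) < min 1 (d z x)" using commute[of x z] by simp
    moreover have "min 1 (d y x) = min 1 (d z x)"
      using fun_cong[OF yz(3), of k] by (simp only: e_def k)
    ultimately show False by linarith
  qed
  have "embedding_map Y euclidean e"
    by (rule continuous_imp_embedding_map[OF cont Y(1) _ inj]) simp
  then obtain e' where "homeomorphic_maps Y (top_of_set (e ` topspace Y)) e e'"
    unfolding embedding_map_def homeomorphic_map_maps by blast
  moreover have "e ` topspace Y \<subseteq> hilbert_cube"
    by (auto simp: e_def hilbert_cube_def)
  ultimately show ?thesis by (intro exI conjI)
qed

lemma compact_ANR_cube:
  assumes "compact_ANR Y"
  obtains S e e' U r where "S \<subseteq> hilbert_cube" "compact S" "homeomorphic_maps Y (top_of_set S) e e'"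
    "openin (top_of_set hilbert_cube) U" "S \<subseteq> U" "continuous_on U r" "r ` U \<subseteq> S"
    "\<forall>u\<in>S. r u = u"
proof -
  have Y: "compact_space Y" "metrizable_space Y"
    and ret: "\<And>S. S \<subseteq> hilbert_cube \<Longrightarrow> top_of_set S homeomorphic_space Y \<Longrightarrow>
      \<exists>U N. openin (top_of_set hilbert_cube) U \<and> S \<subseteq> U \<and> U \<subseteq> N \<and> N \<subseteq> hilbert_cube \<and> S retract_of N"
    using assms unfolding compact_ANR_def by blast+
  obtain S e e' where S: "S \<subseteq> hilbert_cube" and e: "homeomorphic_maps Y (top_of_set S) e e'"
    using compact_metrizable_embeds[OF Y] by blast
  have hom: "Y homeomorphic_space top_of_set S" using e unfolding homeomorphic_space_def by blast
  have "compact_space (top_of_set S)" using homeomorphic_compact_space[OF hom] Y(1) by blast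
  then have "compact S" by (simp add: compact_space_def compactin_subtopology)
  have "top_of_set S homeomorphic_space Y" by (rule homeomorphic_space_sym[THEN iffD1, OF hom])
  then obtain U N where U: "openin (top_of_set hilbert_cube) U" "S \<subseteq> U" "U \<subseteq> N" and N: "S retract_of N"
    using ret[OF S] by blast
  obtain r where "retraction N S r" using N unfolding retract_of_def by blast
  then have r: "continuous_on N r" "r ` N \<subseteq> S" "\<forall>u\<in>S. r u = u"
    unfolding retraction_def by auto
  show ?thesis
  proof (rule that[OF S \<open>compact S\<close> e U(1,2)])
    show "continuous_on U r" using r(1) U(3) by (rule continuous_on_subset)
    show "r ` U \<subseteq> S" using r(2) U(3) by blast
  qed (rule r(3))
qed

lemma compact_near_le:
  fixes F G :: "'z::topological_space \<Rightarrow> nat \<Rightarrow> real"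
  assumes Z: "compact Z" and cont: "continuous_on Z F" "continuous_on Z G"
  shows "compact {z \<in> Z. near_le d (F z) (G z)}"
proof -
  have "{z \<in> Z. near_le d (F z) (G z)} = (\<Inter>i. Z \<inter> (\<lambda>z. \<bar>F z i - G z i\<bar>) -` {..2 ^ i * d})"
    by (auto simp: near_le_def)
  moreover have "closedin (top_of_set Z) (Z \<inter> (\<lambda>z. \<bar>F z i - G z i\<bar>) -` {..2 ^ i * d})" for i
    by (intro continuous_closedin_preimage continuous_on_coordinate_abs_diff cont closed_atMost)
  then have "closedin (top_of_set Z) (\<Inter>i. Z \<inter> (\<lambda>z. \<bar>F z i - G z i\<bar>) -` {..2 ^ i * d})"
    by (intro closedin_INT) auto
  ultimately show ?thesis using closedin_compact[OF Z] by simp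
qed

lemma finite_near_net:
  assumes S: "compact S" "S \<subseteq> hilbert_cube" and d: "0 < d"
  shows "\<exists>s M. (\<forall>y<M. s y \<in> S) \<and> (\<forall>u\<in>S. \<exists>y<M::nat. near d (s y) u)"
proof -
  have op: "openin (top_of_set S) {v \<in> S. near d u v}" if "u \<in> S" for u
  proof -
    have "compact {v \<in> S. \<not> near d u v}"
      by (rule compact_not_near) (use S d that in auto)
    then have "closedin (top_of_set S) {v \<in> S. \<not> near d u v}"
      by (intro closed_subset compact_imp_closed) auto
    moreover have "S - {v \<in> S. \<not> near d u v} = {v \<in> S. near d u v}" by auto
    ultimately show ?thesis unfolding closedin_def by simp
  qed
  have "\<exists>D\<subseteq>(\<lambda>u. {v \<in> S. near d u v}) ` S. finite D \<and> S \<subseteq> \<Union>D"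
  proof (rule S(1)[unfolded compact_eq_openin_cover, rule_format], intro conjI ballI)
    show "S \<subseteq> \<Union>((\<lambda>u. {v \<in> S. near d u v}) ` S)" using near_refl[OF d] by auto
  qed (use op in auto)
  then obtain D where D: "D \<subseteq> (\<lambda>u. {v \<in> S. near d u v}) ` S" "finite D" "S \<subseteq> \<Union>D"
    by iprover
  obtain T where T: "T \<subseteq> S" "finite T" "D = (\<lambda>u. {v \<in> S. near d u v}) ` T"
    using finite_subset_image[OF D(2,1)] by iprover
  obtain l where l: "set l = T" using finite_list[OF T(2)] by blast
  have "\<exists>y<length l. near d (l ! y) u" if u: "u \<in> S" for u
  proof -
    have "u \<in> (\<Union>t\<in>T. {v \<in> S. near d t v})" using D(3) u unfolding T(3) by (rule subsetD)
    then obtain t where "t \<in> set l" "near d t u" using l by blast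
    then show ?thesis unfolding in_set_conv_nth by blast
  qed
  moreover have "l ! y \<in> S" if "y < length l" for y
    using T(1) l nth_mem[OF that] by blast
  ultimately show ?thesis by blast
qed

text \<open>\<epsilon> is the allowed error of a map against a label, \<delta> the error that
  \<open>r\<close> turns into \<epsilon>, and \<eta> the mesh of the net. The factor 4 at \<eta>
  covers two net errors and a variation \<open>2 * \<eta>\<close> of the map.\<close>

locale retract_net =
  fixes Y :: "'b topology" and S U :: "(nat \<Rightarrow> real) set"
    and e :: "'b \<Rightarrow> nat \<Rightarrow> real" and e' :: "(nat \<Rightarrow> real) \<Rightarrow> 'b" and r :: "(nat \<Rightarrow> real) \<Rightarrow> nat \<Rightarrow> real"
    and s :: "nat \<Rightarrow> nat \<Rightarrow> real" and M :: nat and \<epsilon> \<delta> \<eta> :: real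
  assumes S_cube: "S \<subseteq> hilbert_cube"
    and homeo: "homeomorphic_maps Y (top_of_set S) e e'"
    and cont_r: "continuous_on U r" and r_into: "r ` U \<subseteq> S" and r_id: "\<And>u. u \<in> S \<Longrightarrow> r u = u"
    and pos: "0 < \<epsilon>" "0 < \<delta>" "0 < \<eta>" and const: "4 * \<eta> \<le> \<epsilon>" "4 * \<eta> \<le> \<delta>"
    and nbhd: "\<And>u v. u \<in> S \<Longrightarrow> v \<in> hilbert_cube \<Longrightarrow> near (4 * \<epsilon>) u v \<Longrightarrow> v \<in> U"
    and nbhd_r: "\<And>u v. u \<in> S \<Longrightarrow> v \<in> hilbert_cube \<Longrightarrow> near \<delta> u v \<Longrightarrow> v \<in> U \<and> near \<epsilon> u (r v)"
    and net_in: "\<And>y. y < M \<Longrightarrow> s y \<in> S"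
    and net: "\<And>u. u \<in> S \<Longrightarrow> \<exists>y<M. near \<eta> (s y) u"

lemma compact_ANR_retract_net:
  assumes "compact_ANR Y"
  shows "\<exists>S U e e' r s M \<epsilon> \<delta> \<eta>. retract_net Y S U e e' r s M \<epsilon> \<delta> \<eta>"
proof -
  obtain S e e' U r where S: "S \<subseteq> hilbert_cube" "compact S"
    and e: "homeomorphic_maps Y (top_of_set S) e e'"
    and U: "openin (top_of_set hilbert_cube) U" "S \<subseteq> U"
    and r: "continuous_on U r" "r ` U \<subseteq> S" "\<forall>u\<in>S. r u = u"
    using compact_ANR_cube[OF assms] .
  have fst: "continuous_on A fst" and snd: "continuous_on A snd" for A :: "((nat \<Rightarrow> real) \<times> (nat \<Rightarrow> real)) set"
    by (rule continuous_on_fst[OF continuous_on_id], rule continuous_on_snd[OF continuous_on_id])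
  have "compact (hilbert_cube - U)"
    using closedin_compact[OF compact_hilbert_cube, of "hilbert_cube - U"] U(1)
    by (simp add: closedin_diff)
  then have "\<exists>\<sigma>>0. \<forall>z\<in>S \<times> (hilbert_cube - U). \<not> near (0 + \<sigma>) (fst z) (snd z)"
    using S(2) U(2) by (intro compact_separation fst snd compact_Times) (auto simp: near_le_0_iff)
  then obtain \<sigma> where \<sigma>: "0 < \<sigma>"
    "\<And>u v. u \<in> S \<Longrightarrow> v \<in> hilbert_cube \<Longrightarrow> near \<sigma> u v \<Longrightarrow> v \<in> U" by auto
  define \<epsilon> where "\<epsilon> = \<sigma> / 4"
  \<comment> \<open>The closed neighborhood of half the width is compact and still inside
    \<open>U\<close>, where \<open>r\<close> is continuous, so a uniform estimate is available on
    it.\<close>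
  define Z where "Z = {z \<in> S \<times> hilbert_cube. near_le (2 * \<epsilon>) (fst z) (snd z)}"
  have Z: "compact Z"
    unfolding Z_def by (intro compact_near_le compact_Times S(2) compact_hilbert_cube fst snd)
  have ZU: "snd z \<in> U" if "z \<in> Z" for z
  proof (rule \<sigma>(2)[of "fst z"])
    show "near \<sigma> (fst z) (snd z)"
      using that \<sigma>(1) by (intro near_le_imp_near[of "2 * \<epsilon>"]) (auto simp: Z_def \<epsilon>_def)
  qed (use that in \<open>auto simp: Z_def\<close>)
  have "\<exists>\<tau>>0. \<forall>z\<in>Z. near \<tau> (fst z) (snd z) \<longrightarrow> near \<epsilon> (fst z) (r (snd z))"
  proof (rule compact_uniform_near[OF Z fst snd fst])
    show "continuous_on Z (\<lambda>z. r (snd z))"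
      by (rule continuous_on_compose2[OF r(1) snd]) (use ZU in auto)
    show "fst ` Z \<subseteq> hilbert_cube" using S(1) by (auto simp: Z_def)
    show "(\<lambda>z. r (snd z)) ` Z \<subseteq> hilbert_cube" using S(1) r(2) ZU by blast
    show "fst z = r (snd z)" if "z \<in> Z" "fst z = snd z" for z
      using that r(3) by (auto simp: Z_def)
  qed (use \<sigma>(1) in \<open>simp add: \<epsilon>_def\<close>)
  then obtain \<tau> where \<tau>: "0 < \<tau>" "\<And>z. z \<in> Z \<Longrightarrow> near \<tau> (fst z) (snd z) \<Longrightarrow> near \<epsilon> (fst z) (r (snd z))"
    by blast
  \<comment> \<open>The bound \<open>2 * \<epsilon>\<close> puts all \<delta>-near pairs into
    \<open>Z\<close>.\<close>
  define \<delta> where "\<delta> = min \<tau> (2 * \<epsilon>)"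
  define \<eta> where "\<eta> = min \<epsilon> \<delta> / 4"
  have pos: "0 < \<epsilon>" "0 < \<delta>" "0 < \<eta>" using \<sigma>(1) \<tau>(1) by (auto simp: \<epsilon>_def \<delta>_def \<eta>_def)
  obtain s M where net: "\<forall>y<M::nat. s y \<in> S" "\<forall>u\<in>S. \<exists>y<M. near \<eta> (s y) u"
    using finite_near_net[OF S(2,1) pos(3)] by (elim exE conjE) (rule that)
  have "v \<in> U \<and> near \<epsilon> u (r v)" if "u \<in> S" "v \<in> hilbert_cube" "near \<delta> u v" for u v
  proof -
    have "near (2 * \<epsilon>) u v" "near \<tau> u v" using that(3) near_mono by (auto simp: \<delta>_def)
    then have "(u, v) \<in> Z" using that near_imp_near_le by (auto simp: Z_def)
    then show ?thesis using ZU[of "(u, v)"] \<tau>(2)[of "(u, v)"] \<open>near \<tau> u v\<close> by simp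
  qed
  then have "retract_net Y S U e e' r s M \<epsilon> \<delta> \<eta>"
    using S e r pos net \<sigma> by unfold_locales (auto simp: \<epsilon>_def \<eta>_def)
  then show ?thesis by (intro exI)
qed

section \<open>Codes, realizing maps and homotopies\<close>

context retract_net
begin

lemma continuous_map_embed:
  assumes "continuous_map (top_of_set X) Y g"
  shows "continuous_on X (\<lambda>x. e (g x))" and "x \<in> X \<Longrightarrow> e (g x) \<in> S"
    and "x \<in> X \<Longrightarrow> e' (e (g x)) = g x"
proof -
  have "continuous_map (top_of_set X) (top_of_set S) (e \<circ> g)"
    using assms homeo unfolding homeomorphic_maps_def by (blast intro: continuous_map_compose)
  then show "continuous_on X (\<lambda>x. e (g x))" "x \<in> X \<Longrightarrow> e (g x) \<in> S"
    by (auto simp: o_def)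
  show "e' (e (g x)) = g x" if "x \<in> X"
    using homeo continuous_map_funspace[OF assms] that unfolding homeomorphic_maps_def by auto
qed

lemma continuous_map_unembed:
  assumes "continuous_on X f" "f ` X \<subseteq> S"
  shows "continuous_map (top_of_set X) Y (\<lambda>x. e' (f x))" and "x \<in> X \<Longrightarrow> e (e' (f x)) = f x"
proof -
  have "continuous_map (top_of_set X) (top_of_set S) f"
    using assms by auto
  moreover have "continuous_map (top_of_set S) Y e'"
    using homeo unfolding homeomorphic_maps_def by blast
  ultimately have "continuous_map (top_of_set X) Y (e' \<circ> f)"
    by (rule continuous_map_compose)
  then show "continuous_map (top_of_set X) Y (\<lambda>x. e' (f x))" by (simp add: o_def)
  show "e (e' (f x)) = f x" if "x \<in> X"
    using homeo assms(2) that unfolding homeomorphic_maps_def by auto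
qed

lemma homotopic_near:
  assumes g: "continuous_map (top_of_set X) Y g" and g': "continuous_map (top_of_set X) Y g'"
    and near: "\<And>x. x \<in> X \<Longrightarrow> near (4 * \<epsilon>) (e (g x)) (e (g' x))"
  shows "homotopic_with (\<lambda>_. True) (top_of_set X) Y g g'"
proof -
  define v where "v p = (\<lambda>i. (1 - fst p) * e (g (snd p)) i + fst p * e (g' (snd p)) i)" for p
  define h where "h p = e' (r (v p))" for p
  have cube: "e (g x) \<in> hilbert_cube" "e (g' x) \<in> hilbert_cube" if "x \<in> X" for x
    using continuous_map_embed(2)[OF g that] continuous_map_embed(2)[OF g' that] S_cube by auto
  have vU: "v p \<in> U" if pin: "p \<in> {0..1} \<times> X" for p
  proof -
    obtain t x where p: "p = (t, x)" "0 \<le> t" "t \<le> 1" "x \<in> X"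
      using pin by (cases p) auto
    have "v p \<in> hilbert_cube"
    proof -
      have "(1 - t) * a + t * b \<le> 1" if "a \<le> 1" "b \<le> 1" for a b :: real
        using p(2,3) that by (rule_tac convex_bound_le) auto
      then show ?thesis using cube[OF p(4)] p(2,3) by (auto simp: v_def p(1) hilbert_cube_def)
    qed
    \<comment> \<open>No point of the segment is farther from \<open>e (g x)\<close> than its other
      end, so \<open>e (g x)\<close> serves throughout as the nearby point of
      \<open>S\<close>.\<close>
    moreover have "near (4 * \<epsilon>) (e (g x)) (v p)"
      unfolding near_def
    proof
      fix i
      have "e (g x) i - v p i = t * (e (g x) i - e (g' x) i)"
        by (simp add: v_def p(1) algebra_simps)
      then have "\<bar>e (g x) i - v p i\<bar> = t * \<bar>e (g x) i - e (g' x) i\<bar>"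
        using p(2) by (simp add: abs_mult)
      also have "\<dots> \<le> \<bar>e (g x) i - e (g' x) i\<bar>"
        using p(2,3) by (intro mult_left_le_one_le) auto
      also have "\<dots> < 2 ^ i * (4 * \<epsilon>)" using near[OF p(4)] unfolding near_def by blast
      finally show "\<bar>e (g x) i - v p i\<bar> < 2 ^ i * (4 * \<epsilon>)" .
    qed
    ultimately show ?thesis using nbhd continuous_map_embed(2)[OF g p(4)] by blast
  qed
  have coord: "continuous_on ({0..1} \<times> X) (\<lambda>p. e (k (snd p)) i)"
    if "continuous_map (top_of_set X) Y k" for k i
    by (rule continuous_on_compose2[OF continuous_on_product_then_coordinatewise[OF continuous_map_embed(1)[OF that]]
          continuous_on_snd[OF continuous_on_id]]) auto
  have "continuous_on ({0..1} \<times> X) v"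
  proof (rule continuous_on_coordinatewise_then_product)
    fix i
    show "continuous_on ({0..1} \<times> X) (\<lambda>p. v p i)"
      unfolding v_def
      by (intro continuous_on_add continuous_on_mult continuous_on_diff continuous_on_const
          continuous_on_fst continuous_on_id coord g g')
  qed
  then have "continuous_on ({0..1} \<times> X) (\<lambda>p. r (v p))"
    by (rule continuous_on_compose2[OF cont_r]) (use vU in blast)
  then have "continuous_map (top_of_set ({0..1} \<times> X)) Y h"
    unfolding h_def by (rule continuous_map_unembed) (use vU r_into in blast)
  moreover have "h (0, x) = g x" "h (1, x) = g' x" if "x \<in> X" for x
    using r_id[OF continuous_map_embed(2)[OF g that]] continuous_map_embed(3)[OF g that]
      r_id[OF continuous_map_embed(2)[OF g' that]] continuous_map_embed(3)[OF g' that]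
    by (simp_all add: h_def v_def)
  ultimately show ?thesis
    by (subst homotopic_with) (auto intro!: exI[of _ h])
qed

text \<open>A label \<open>y < M\<close> stands for the point \<open>s y\<close> of the net. A code represents on \<open>X\<close> the maps that are
  close to the label of every ball at the points of \<open>X\<close> in the corresponding closed box.\<close>

definition close_labels :: "real \<Rightarrow> (nat \<times> nat) set" where
  "close_labels d = {(y, y'). y < M \<and> y' < M \<and> near d (s y) (s y')}"

text \<open>Closeness \<delta> is what \<open>nbhd_r\<close> asks of an average of labels. As no
  ball is apart from itself, this also forces all labels below \<open>M\<close>.\<close>

definition valid :: "nat \<Rightarrow> bool" where
  "valid i \<longleftrightarrow> compatible (close_labels \<delta>) i i"

definition codes :: "(nat \<Rightarrow> real) set \<Rightarrow> nat set" where
  "codes X = {i. valid i \<and> X \<subseteq> rat_open (p1 i)}"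

text \<open>The width \<open>2 * \<epsilon>\<close> is small enough for realizing maps of linked
  codes to be \<open>4 * \<epsilon>\<close>-near, and large enough for a code of a map to be linked
  to all fine codes of it, whose labels differ by at most \<epsilon> + \<eta>.\<close>

definition linked :: "nat \<Rightarrow> nat \<Rightarrow> bool" where
  "linked = compatible (close_labels (2 * \<epsilon>))"

definition realizes :: "(nat \<Rightarrow> real) set \<Rightarrow> ((nat \<Rightarrow> real) \<Rightarrow> 'b) \<Rightarrow> nat \<Rightarrow> bool" where
  "realizes X g i \<longleftrightarrow> continuous_map (top_of_set X) Y g \<and>
    (\<forall>(b, y)\<in>entries i. \<forall>x\<in>X. near_le (radius b) (center b) x \<longrightarrow> near \<epsilon> (s y) (e (g x)))"

text \<open>Never decided, only used in arguments: it forces small balls close to \<open>X\<close>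
  whose labels come from actual values of \<open>g\<close>. Sufficient fineness then yields
  validity, realization and links.\<close>

definition approximates :: "(nat \<Rightarrow> real) set \<Rightarrow> ((nat \<Rightarrow> real) \<Rightarrow> 'b) \<Rightarrow> real \<Rightarrow> nat \<Rightarrow> bool" where
  "approximates X g \<sigma> j \<longleftrightarrow> (\<forall>(b, y)\<in>entries j. radius b < \<sigma> \<and> y < M \<and>
    (\<exists>x\<in>X. near \<sigma> (center b) x \<and> near \<eta> (s y) (e (g x))))"

lemma finite_close_labels: "finite (close_labels d)"
  by (rule finite_subset[of _ "{..<M} \<times> {..<M}"]) (auto simp: close_labels_def)

lemma codes_mono: "A \<subseteq> X \<Longrightarrow> codes X \<subseteq> codes A"
  by (auto simp: codes_def)

lemma realizes_subset:
  assumes "realizes X g i" "A \<subseteq> X"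
  shows "realizes A g i"
  using assms continuous_map_from_subtopology_mono unfolding realizes_def by blast

lemma code_entry:
  assumes "i \<in> codes X" "x \<in> X"
  obtains b y where "(b, y) \<in> entries i" "x \<in> rat_ball b"
  using assms unfolding codes_def rat_open_eq by auto

lemma valid_label: "valid i \<Longrightarrow> (b, y) \<in> entries i \<Longrightarrow> y < M"
proof -
  assume i: "valid i" "(b, y) \<in> entries i"
  have "\<not> apart b b" using radius_pos[of b] by (simp add: apart_def near_refl)
  then show "y < M" using i unfolding valid_def compatible_def close_labels_def by blast
qed

lemma linked_sym: "linked i j \<Longrightarrow> linked j i"
proof -
  have "apart b b' \<longleftrightarrow> apart b' b" for b b'
    by (simp add: apart_def near_commute[of _ "center b"] add.commute)
  then show "linked i j \<Longrightarrow> linked j i"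
    unfolding linked_def compatible_def close_labels_def
    using near_commute[of "2 * \<epsilon>"] by fast
qed

text \<open>A point of \<open>X\<close> lies in a ball of each code. These balls are not apart, so
  their labels are \<open>2 * \<epsilon>\<close>-near, and each map adds an error
  \<epsilon>.\<close>

lemma linked_homotopic:
  assumes "i \<in> codes X" "j \<in> codes X" and link: "linked i j" and g: "realizes X g i" and g': "realizes X g' j"
  shows "homotopic_with (\<lambda>_. True) (top_of_set X) Y g g'"
proof (rule homotopic_near)
  fix x assume x: "x \<in> X"
  obtain b y where en: "(b, y) \<in> entries i" "x \<in> rat_ball b" using code_entry[OF assms(1) x] .
  obtain b' y' where en': "(b', y') \<in> entries j" "x \<in> rat_ball b'" using code_entry[OF assms(2) x] .
  note near = rat_ball_near[OF en(2)] and near' = rat_ball_near[OF en'(2)]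
  have "\<not> apart b b'"
    using near_triangle[OF near near'[unfolded near_commute[of _ _ x]]] by (simp add: apart_def)
  then have "near (2 * \<epsilon>) (s y) (s y')"
    using link en(1) en'(1) unfolding linked_def compatible_def close_labels_def by blast
  moreover have "near \<epsilon> (s y) (e (g x))"
    using g en(1) x near_imp_near_le[OF near] unfolding realizes_def by blast
  moreover have "near \<epsilon> (s y') (e (g' x))"
    using g' en'(1) x near_imp_near_le[OF near'] unfolding realizes_def by blast
  ultimately have "near (\<epsilon> + 2 * \<epsilon> + \<epsilon>) (e (g x)) (e (g' x))"
    using near_triangle near_commute by blast
  then show "near (4 * \<epsilon>) (e (g x)) (e (g' x))" by simp
qed (use g g' in \<open>auto simp: realizes_def\<close>)

lemma realizes_unique:
  assumes "i \<in> codes X" "realizes X g i" "realizes X g' i"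
  shows "homotopic_with (\<lambda>_. True) (top_of_set X) Y g g'"
proof (rule homotopic_near)
  fix x assume x: "x \<in> X"
  obtain b y where en: "(b, y) \<in> entries i" "x \<in> rat_ball b" using code_entry[OF assms(1) x] .
  have "near \<epsilon> (s y) (e (g x))" "near \<epsilon> (s y) (e (g' x))"
    using assms(2,3) en(1) x near_imp_near_le[OF rat_ball_near[OF en(2)]]
    unfolding realizes_def by blast+
  then have "near (\<epsilon> + \<epsilon>) (e (g x)) (e (g' x))" using near_triangle near_commute by blast
  then show "near (4 * \<epsilon>) (e (g x)) (e (g' x))" using near_mono pos(1) by force
qed (use assms in \<open>auto simp: realizes_def\<close>)

text \<open>At a point of a closed box, only labels of balls containing that point are averaged.
  None of them is apart from the ball of the box, so the average is \<delta>-near its label and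
  \<open>r\<close> keeps it within \<epsilon>.\<close>

lemma ex_realizer:
  assumes i: "i \<in> codes X" and X: "X \<subseteq> hilbert_cube"
  shows "\<exists>g. realizes X g i"
proof -
  \<comment> \<open>On the cube this weight is positive exactly inside the ball.\<close>
  define w where "w p x = max 0 (radius (fst p) - hc_dist (center (fst p)) x)" for p :: "nat \<times> nat" and x
  define W where "W x = (\<Sum>p\<in>entries i. w p x)" for x
  define v where "v x = (\<lambda>n. (\<Sum>p\<in>entries i. w p x * s (snd p) n) / W x)" for x
  have w: "0 \<le> w p x" for p x by (simp add: w_def)
  have W: "0 < W x" if x: "x \<in> X" for x
  proof -
    obtain b y where "(b, y) \<in> entries i" "x \<in> rat_ball b" using code_entry[OF i x] .
    then show ?thesis
      unfolding W_def using w finite_entries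
      by (intro sum_pos2[of _ "(b, y)"]) (auto simp: w_def rat_ball_eq hc_ball_def)
  qed
  have s: "s (snd p) n \<in> {0..1}" if "p \<in> entries i" for p n
    using that valid_label[of i "fst p" "snd p"] i net_in S_cube
    by (auto simp: codes_def hilbert_cube_def subset_iff)
  have v_cube: "v x \<in> hilbert_cube" if x: "x \<in> X" for x
  proof -
    have "(\<Sum>p\<in>entries i. w p x * s (snd p) n) \<le> W x" for n
      unfolding W_def using s w by (intro sum_mono mult_left_le) auto
    moreover have "0 \<le> (\<Sum>p\<in>entries i. w p x * s (snd p) n)" for n
      using s w by (intro sum_nonneg mult_nonneg_nonneg) auto
    ultimately show ?thesis using W[OF x] by (simp add: v_def hilbert_cube_def)
  qed
  have near_v: "near \<delta> (s y) (v x)"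
    if x: "x \<in> X" and en: "(b, y) \<in> entries i" "near_le (radius b) (center b) x" for x b y
    unfolding v_def W_def
  proof (rule near_convex[OF finite_entries w W[OF x, unfolded W_def]])
    fix p assume p: "p \<in> entries i" "0 < w p x"
    have "near (radius (fst p)) (center (fst p)) x"
      using p(2) x X near_of_hc_dist[OF center_in_cube] by (auto simp: w_def)
    \<comment> \<open>A nonstrict and a strict inequality add up to a strict one, so closed boxes
      are handled as well as open balls.\<close>
    then have "near (radius b + radius (fst p)) (center b) (center (fst p))"
      using near_le_near_triangle[OF en(2)] near_commute by blast
    then have "\<not> apart b (fst p)" by (simp add: apart_def)
    then show "near \<delta> (s y) (s (snd p))"
      using i en(1) p(1) unfolding codes_def valid_def compatible_def close_labels_def by fastforce
  qed
  have v_r: "v x \<in> U \<and> near \<epsilon> (s y) (r (v x))"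
    if x: "x \<in> X" and en: "(b, y) \<in> entries i" "near_le (radius b) (center b) x" for x b y
    using nbhd_r[OF net_in v_cube[OF x] near_v[OF that]] valid_label[OF _ en(1)] i
    by (simp add: codes_def)
  have vU: "v x \<in> U" if x: "x \<in> X" for x
  proof -
    obtain b y where "(b, y) \<in> entries i" "x \<in> rat_ball b" using code_entry[OF i x] .
    then show ?thesis using v_r[OF x] near_imp_near_le[OF rat_ball_near] by blast
  qed
  have cont_w: "continuous_on X (w p)" for p
    unfolding w_def
    by (intro continuous_on_max continuous_on_const continuous_on_diff
        continuous_on_subset[OF continuous_on_hc_dist[OF center_in_cube] X])
  have cont_v: "continuous_on X v"
  proof (rule continuous_on_coordinatewise_then_product)
    fix n
    show "continuous_on X (\<lambda>x. v x n)"
      unfolding v_def W_def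
      by (intro continuous_on_divide continuous_on_sum continuous_on_mult continuous_on_const cont_w ballI)
        (use W in \<open>force simp: W_def\<close>)
  qed
  have rv: "continuous_on X (\<lambda>x. r (v x))" "(\<lambda>x. r (v x)) ` X \<subseteq> S"
    using continuous_on_compose2[OF cont_r cont_v] vU r_into by blast+
  have "realizes X (\<lambda>x. e' (r (v x))) i"
    unfolding realizes_def
  proof (intro conjI ballI, goal_cases)
    case 1
    show ?case by (rule continuous_map_unembed(1)[OF rv])
  next
    case (2 p)
    then show ?case using v_r continuous_map_unembed(2)[OF rv] by (auto split: prod.splits)
  qed
  then show ?thesis by blast
qed

section \<open>Fine codes of a given map\<close>

lemma approximates_mono:
  assumes "approximates X g \<sigma> j" "\<sigma> \<le> \<sigma>'"
  shows "approximates X g \<sigma>' j"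
  unfolding approximates_def
proof (intro ballI, clarsimp)
  fix b y assume "(b, y) \<in> entries j"
  then obtain x where x: "radius b < \<sigma>" "y < M" "x \<in> X" "near \<sigma> (center b) x" "near \<eta> (s y) (e (g x))"
    using assms(1) unfolding approximates_def by blast
  have "radius b < \<sigma>'" using x(1) assms(2) by simp
  then show "radius b < \<sigma>' \<and> y < M \<and> (\<exists>x\<in>X. near \<sigma>' (center b) x \<and> near \<eta> (s y) (e (g x)))"
    using x(2,3,5) near_mono[OF x(4) assms(2)] by blast
qed

text \<open>Each point chooses a small ball around itself and a net label for its value; compactness
  leaves finitely many.\<close>

lemma ex_approximates:
  assumes X: "compact X" "X \<subseteq> hilbert_cube" and g: "\<And>x. x \<in> X \<Longrightarrow> e (g x) \<in> S" and \<sigma>: "0 < \<sigma>"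
  shows "\<exists>j. approximates X g \<sigma> j \<and> X \<subseteq> rat_open (p1 j)"
proof -
  have "\<forall>x\<in>X. \<exists>b. x \<in> rat_ball b \<and> radius b < \<sigma>"
    using ex_small_rat_ball[OF _ \<sigma>] X(2) by blast
  then obtain B where B: "\<And>x. x \<in> X \<Longrightarrow> x \<in> rat_ball (B x)" "\<And>x. x \<in> X \<Longrightarrow> radius (B x) < \<sigma>"
    by metis
  have "\<forall>x\<in>X. \<exists>y<M. near \<eta> (s y) (e (g x))" using net g by blast
  then obtain L where L: "\<And>x. x \<in> X \<Longrightarrow> L x < M" "\<And>x. x \<in> X \<Longrightarrow> near \<eta> (s (L x)) (e (g x))"
    by metis
  have "\<exists>D\<subseteq>(\<lambda>x. X \<inter> rat_ball (B x)) ` X. finite D \<and> X \<subseteq> \<Union>D"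
  proof (rule X(1)[unfolded compact_eq_openin_cover, rule_format], intro conjI ballI)
    show "X \<subseteq> \<Union>((\<lambda>x. X \<inter> rat_ball (B x)) ` X)" using B(1) by blast
    show "openin (top_of_set X) c" if c_in: "c \<in> (\<lambda>x. X \<inter> rat_ball (B x)) ` X" for c
    proof -
      obtain b where c: "c = rat_ball b \<inter> X" using c_in by blast
      have "hilbert_cube \<inter> X = X" using X(2) by blast
      then show ?thesis
        using openin_subtopology_Int[OF openin_rat_ball[of b], of X]
        by (simp add: c subtopology_subtopology)
    qed
  qed
  then obtain D where D: "D \<subseteq> (\<lambda>x. X \<inter> rat_ball (B x)) ` X" "finite D" "X \<subseteq> \<Union>D"
    by iprover
  obtain T where T: "T \<subseteq> X" "finite T" "D = (\<lambda>x. X \<inter> rat_ball (B x)) ` T"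
    using finite_subset_image[OF D(2,1)] by iprover
  obtain l where l: "set l = (\<lambda>x. (B x, L x)) ` T"
    using finite_list[OF finite_imageI[OF T(2)]] ..
  obtain j where j: "entries j = (\<lambda>x. (B x, L x)) ` T"
    using entries_surj[of l] unfolding l ..
  have "X \<subseteq> rat_open (p1 j)"
    using D(3) unfolding rat_open_eq j T(3) by auto
  moreover have "approximates X g \<sigma> j"
    unfolding approximates_def j
  proof (intro ballI, clarsimp)
    fix x assume "x \<in> T"
    then have x: "x \<in> X" using T(1) by blast
    have "near \<sigma> (center (B x)) x"
      using near_mono[OF rat_ball_near[OF B(1)[OF x]]] B(2)[OF x] by simp
    then show "radius (B x) < \<sigma> \<and> L x < M \<and> (\<exists>x'\<in>X. near \<sigma> (center (B x)) x' \<and> near \<eta> (s (L x)) (e (g x')))"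
      using B(2)[OF x] L[OF x] x by blast
  qed
  ultimately show ?thesis by blast
qed

text \<open>The factor 4 counts the way from \<open>x\<close> to \<open>x'\<close>: \<sigma> to each
  center and \<open>2 * \<sigma>\<close> between centers of balls that are not apart. Labels differ
  by two net errors and the variation \<kappa>. With \<open>g' = g\<close> this gives validity, with
  two stages of a homotopy a link.\<close>

lemma approximates_labels:
  assumes unif: "\<And>x x'. x \<in> X \<Longrightarrow> x' \<in> X \<Longrightarrow> near (4 * \<sigma>) x x' \<Longrightarrow> near \<kappa> (e (g x)) (e (g' x'))"
    and j: "approximates X g \<sigma> j" and j': "approximates X g' \<sigma> j'" and d: "2 * \<eta> + \<kappa> \<le> d"
  shows "compatible (close_labels d) j j'"
proof -
  have "near d (s y) (s y') \<and> y < M \<and> y' < M"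
    if en: "(b, y) \<in> entries j" "(b', y') \<in> entries j'" and "\<not> apart b b'" for b y b' y'
  proof -
    obtain x where x: "x \<in> X" "near \<sigma> (center b) x" "near \<eta> (s y) (e (g x))" "radius b < \<sigma>" "y < M"
      using j en(1) unfolding approximates_def by blast
    obtain x' where x': "x' \<in> X" "near \<sigma> (center b') x'" "near \<eta> (s y') (e (g' x'))" "radius b' < \<sigma>" "y' < M"
      using j' en(2) unfolding approximates_def by blast
    have c: "near (2 * \<sigma>) (center b) (center b')"
      using that(3) x(4) x'(4) near_mono[of "radius b + radius b'" _ _ "2 * \<sigma>"] by (simp add: apart_def)
    have "near (\<sigma> + 2 * \<sigma> + \<sigma>) x x'"
      by (rule near_triangle[OF near_triangle[OF x(2)[unfolded near_commute[of _ "center b"]] c] x'(2)])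
    then have "near \<kappa> (e (g x)) (e (g' x'))" using unif[OF x(1) x'(1)] by simp
    from near_triangle[OF near_triangle[OF x(3) this] x'(3)[unfolded near_commute[of _ "s y'"]]]
    have "near d (s y) (s y')" by (rule near_mono) (use d in simp)
    then show ?thesis using x(5) x'(5) by blast
  qed
  then show ?thesis unfolding compatible_def close_labels_def by blast
qed

text \<open>By uniform continuity at scale \<eta>, the value at a point of a small closed box is
  within \<eta> of the value at the sample point, hence within \<open>2 * \<eta>\<close> of the
  label.\<close>

lemma approximates_realizes:
  assumes X: "compact X" "X \<subseteq> hilbert_cube" and g: "continuous_map (top_of_set X) Y g"
  shows "\<exists>\<sigma>>0. \<forall>j. approximates X g \<sigma> j \<longrightarrow> valid j \<and> realizes X g j"
proof -
  have "(\<lambda>x. e (g x)) ` X \<subseteq> hilbert_cube" using continuous_map_embed(2)[OF g] S_cube by blast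
  from near_uniform_continuity[OF X(1) continuous_map_embed(1)[OF g] this pos(3)]
  obtain \<tau> where \<tau>: "0 < \<tau>" "\<And>x x'. x \<in> X \<Longrightarrow> x' \<in> X \<Longrightarrow> near \<tau> x x' \<Longrightarrow> near \<eta> (e (g x)) (e (g x'))"
    by blast
  have "valid j \<and> realizes X g j" if j: "approximates X g (\<tau> / 4) j" for j
  proof
    show "valid j"
      unfolding valid_def
    proof (rule approximates_labels[OF _ j j])
      show "near \<eta> (e (g x)) (e (g x'))" if "x \<in> X" "x' \<in> X" "near (4 * (\<tau> / 4)) x x'" for x x'
        using \<tau>(2)[OF that(1,2)] that(3) by simp
    qed (use const pos in simp)
    have "near \<epsilon> (s y) (e (g x))"
      if en: "(b, y) \<in> entries j" and x: "x \<in> X" "near_le (radius b) (center b) x" for b y x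
    proof -
      obtain x' where x': "x' \<in> X" "near (\<tau> / 4) (center b) x'" "near \<eta> (s y) (e (g x'))" "radius b < \<tau> / 4"
        using j en unfolding approximates_def by blast
      have "near (\<tau> / 4 + \<tau> / 4) x' x"
        by (rule near_triangle[OF x'(2)[unfolded near_commute[of _ "center b"]] near_le_imp_near[OF x(2) x'(4)]])
      then have "near \<tau> x' x" using \<tau>(1) near_mono[of _ x' x \<tau>] by simp
      then have "near (\<eta> + \<eta>) (s y) (e (g x))" using near_triangle[OF x'(3) \<tau>(2)[OF x'(1) x(1)]] by blast
      then show ?thesis using const(1) pos(3) near_mono[of "\<eta> + \<eta>" _ _ \<epsilon>] by simp
    qed
    then show "realizes X g j" using g unfolding realizes_def by blast
  qed
  then show ?thesis using \<tau>(1) by (intro exI[of _ "\<tau> / 4"]) simp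
qed

lemma ex_approximating_code:
  assumes X: "compact X" "X \<subseteq> hilbert_cube" and g: "continuous_map (top_of_set X) Y g" and \<sigma>: "0 < \<sigma>"
  shows "\<exists>j\<in>codes X. realizes X g j \<and> approximates X g \<sigma> j"
proof -
  obtain \<tau> where \<tau>: "0 < \<tau>" "\<And>j. approximates X g \<tau> j \<Longrightarrow> valid j \<and> realizes X g j"
    using approximates_realizes[OF X g] by blast
  have "0 < min \<sigma> \<tau>" using \<sigma> \<tau>(1) by simp
  from ex_approximates[OF X, of g, OF continuous_map_embed(2)[OF g] this]
  obtain j where j: "approximates X g (min \<sigma> \<tau>) j" "X \<subseteq> rat_open (p1 j)" by blast
  have "approximates X g \<sigma> j" "approximates X g \<tau> j"
    using approximates_mono[OF j(1)] by simp_all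
  then show ?thesis using \<tau>(2) j(2) unfolding codes_def by blast
qed

text \<open>Here the closed boxes in \<open>realizes\<close> pay off: the estimate for each label of
  \<open>i\<close> extends to a slightly larger open box. A small ball of \<open>j\<close> not apart
  from a ball of \<open>i\<close> has its sample point in that larger box.\<close>

lemma realizer_linked:
  assumes X: "compact X" and i: "i \<in> codes X" and g: "realizes X g i"
  shows "\<exists>\<sigma>>0. \<forall>j. approximates X g \<sigma> j \<longrightarrow> linked i j"
proof -
  have cont: "continuous_map (top_of_set X) Y g" using g by (simp add: realizes_def)
  have cube: "(\<lambda>x. e (g x)) ` X \<subseteq> hilbert_cube" using continuous_map_embed(2)[OF cont] S_cube by blast
  have valid: "valid i" using i by (simp add: codes_def)
  have "\<exists>\<sigma>>0. \<forall>x\<in>X. near (radius (fst p) + \<sigma>) (center (fst p)) x \<longrightarrow> near \<epsilon> (s (snd p)) (e (g x))"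
    if p: "p \<in> entries i" for p
  proof (rule near_gap[OF X continuous_map_embed(1)[OF cont] cube _ pos(1)])
    show "s (snd p) \<in> hilbert_cube"
      using net_in valid_label[OF valid, of "fst p" "snd p"] p S_cube by auto
    show "near \<epsilon> (s (snd p)) (e (g x))" if "x \<in> X" "near_le (radius (fst p)) (center (fst p)) x" for x
      using g that p unfolding realizes_def by (cases p) auto
  qed
  then obtain \<tau> where \<tau>: "\<And>p. p \<in> entries i \<Longrightarrow> 0 < \<tau> p"
    "\<And>p x. p \<in> entries i \<Longrightarrow> x \<in> X \<Longrightarrow> near (radius (fst p) + \<tau> p) (center (fst p)) x \<Longrightarrow>
      near \<epsilon> (s (snd p)) (e (g x))" by metis
  \<comment> \<open>Halved because the radius of the second ball and the distance from its center to
    the sample point both enlarge the box; the inserted 1 covers an empty list of balls.\<close>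
  define \<sigma> where "\<sigma> = Min (insert 1 (\<tau> ` entries i)) / 2"
  have \<sigma>: "0 < \<sigma>" using \<tau>(1) finite_entries by (simp add: \<sigma>_def)
  have \<sigma>_le: "2 * \<sigma> \<le> \<tau> p" if "p \<in> entries i" for p
    using that finite_entries by (simp add: \<sigma>_def)
  have "linked i j" if j: "approximates X g \<sigma> j" for j
  proof -
    have "near (2 * \<epsilon>) (s y) (s y') \<and> y < M \<and> y' < M"
      if en: "(b, y) \<in> entries i" "(b', y') \<in> entries j" and na: "\<not> apart b b'" for b y b' y'
    proof -
      obtain x where x: "x \<in> X" "near \<sigma> (center b') x" "near \<eta> (s y') (e (g x))" "radius b' < \<sigma>" "y' < M"
        using j en(2) unfolding approximates_def by blast
      have "near (radius b + radius b' + \<sigma>) (center b) x"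
        using na near_triangle[OF _ x(2)] by (simp add: apart_def)
      then have "near (radius b + \<tau> (b, y)) (center b) x"
        using \<sigma>_le[OF en(1)] x(4) near_mono[of _ "center b" x] by simp
      then have "near \<epsilon> (s y) (e (g x))" using \<tau>(2)[OF en(1) x(1)] by simp
      then have "near (\<epsilon> + \<eta>) (s y) (s y')" using near_triangle near_commute x(3) by blast
      then have "near (2 * \<epsilon>) (s y) (s y')" using const(1) pos near_mono[of _ "s y" "s y'"] by simp
      then show ?thesis using x(5) valid_label[OF valid en(1)] by blast
    qed
    then show ?thesis unfolding linked_def compatible_def close_labels_def by blast
  qed
  then show ?thesis using \<sigma> by blast
qed

lemma homotopic_imp_linked:
  assumes X: "compact X" "X \<subseteq> hilbert_cube" and i: "i \<in> codes X" "realizes X g i"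
    and j: "j \<in> codes X" "realizes X g' j" and hom: "homotopic_with (\<lambda>_. True) (top_of_set X) Y g g'"
  shows "(i, j) \<in> {(a, b). a \<in> codes X \<and> b \<in> codes X \<and> linked a b}\<^sup>*" (is "_ \<in> ?L\<^sup>*")
proof -
  obtain h where h: "continuous_map (top_of_set ({0..1::real} \<times> X)) Y h"
    "\<And>x. h (0, x) = g x" "\<And>x. h (1, x) = g' x"
    using hom unfolding homotopic_with_def by auto
  have emb: "continuous_on ({0..1} \<times> X) (\<lambda>p. e (h p))" "(\<lambda>p. e (h p)) ` ({0..1} \<times> X) \<subseteq> hilbert_cube"
  proof -
    have "continuous_map (top_of_set ({0..1} \<times> X)) (top_of_set S) (e \<circ> h)"
      using h(1) homeo unfolding homeomorphic_maps_def by (blast intro: continuous_map_compose)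
    then show "continuous_on ({0..1} \<times> X) (\<lambda>p. e (h p))" "(\<lambda>p. e (h p)) ` ({0..1} \<times> X) \<subseteq> hilbert_cube"
      using S_cube by (auto simp: o_def)
  qed
  have "0 < 2 * \<eta>" using pos(3) by simp
  from near_homotopy[OF X(1) emb this] obtain \<tau> where \<tau>: "0 < \<tau>"
    "\<And>t t' x x'. t \<in> {0..1} \<Longrightarrow> t' \<in> {0..1} \<Longrightarrow> x \<in> X \<Longrightarrow> x' \<in> X \<Longrightarrow> \<bar>t - t'\<bar> < \<tau> \<Longrightarrow>
      near \<tau> x x' \<Longrightarrow> near (2 * \<eta>) (e (h (t, x))) (e (h (t', x')))" by blast
  obtain \<sigma>i where \<sigma>i: "0 < \<sigma>i" "\<And>k. approximates X g \<sigma>i k \<Longrightarrow> linked i k"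
    using realizer_linked[OF X(1) i] by blast
  obtain \<sigma>j where \<sigma>j: "0 < \<sigma>j" "\<And>k. approximates X g' \<sigma>j k \<Longrightarrow> linked j k"
    using realizer_linked[OF X(1) j] by blast
  \<comment> \<open>Fine enough to link consecutive stages and to attach \<open>i\<close> and
    \<open>j\<close> to the first and the last stage.\<close>
  define \<sigma> where "\<sigma> = min (\<tau> / 4) (min \<sigma>i \<sigma>j)"
  have \<sigma>: "0 < \<sigma>" "4 * \<sigma> \<le> \<tau>" "\<sigma> \<le> \<sigma>i" "\<sigma> \<le> \<sigma>j" using \<tau>(1) \<sigma>i(1) \<sigma>j(1) by (auto simp: \<sigma>_def)
  obtain m where m: "1 / real (Suc m) < \<tau>" using nat_approx_posE[OF \<tau>(1)] by metis
  define t where "t k = real k / real (Suc m)" for k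
  have t: "t k \<in> {0..1}" if "k \<le> Suc m" for k using that by (simp add: t_def)
  define f where "f k = (\<lambda>x. h (t k, x))" for k
  have f_cont: "continuous_map (top_of_set X) Y (f k)" if k: "k \<le> Suc m" for k
  proof -
    have "continuous_map (top_of_set X) (top_of_set ({0..1} \<times> X)) (\<lambda>x. (t k, x))"
      using t[OF k] by (auto intro!: continuous_on_Pair continuous_on_const continuous_on_id)
    from continuous_map_compose[OF this h(1)] show ?thesis by (simp add: f_def o_def)
  qed
  have "\<exists>c. k \<le> Suc m \<longrightarrow> c \<in> codes X \<and> approximates X (f k) \<sigma> c" for k
    using ex_approximating_code[OF X f_cont \<sigma>(1)] by blast
  then obtain c where c: "\<And>k. k \<le> Suc m \<Longrightarrow> c k \<in> codes X" "\<And>k. k \<le> Suc m \<Longrightarrow> approximates X (f k) \<sigma> (c k)"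
    by metis
  \<comment> \<open>\<open>homotopic_with\<close> prescribes both ends for all arguments, so these
    are equalities of functions and not only on \<open>X\<close>.\<close>
  have f0: "f 0 = g" and f1: "f (Suc m) = g'" using h(2,3) by (auto simp: f_def t_def)
  have step: "(c k, c (Suc k)) \<in> ?L" if k: "k < Suc m" for k
  proof -
    have k': "k \<le> Suc m" "Suc k \<le> Suc m" using k by auto
    have "t (Suc k) - t k = 1 / real (Suc m)" unfolding t_def by (simp add: diff_divide_distrib[symmetric])
    moreover have "0 < 1 / real (Suc m)" by simp
    ultimately have tt: "\<bar>t k - t (Suc k)\<bar> < \<tau>" using m by linarith
    have "linked (c k) (c (Suc k))"
      unfolding linked_def
    proof (rule approximates_labels[OF _ c(2)[OF k'(1)] c(2)[OF k'(2)]])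
      show "near (2 * \<eta>) (e (f k x)) (e (f (Suc k) x'))" if "x \<in> X" "x' \<in> X" "near (4 * \<sigma>) x x'" for x x'
        unfolding f_def using \<tau>(2)[OF t[OF k'(1)] t[OF k'(2)] that(1,2) tt] near_mono[OF that(3) \<sigma>(2)] by blast
    qed (use const pos in simp)
    then show ?thesis using c(1)[OF k'(1)] c(1)[OF k'(2)] by blast
  qed
  have chain: "(c 0, c k) \<in> ?L\<^sup>*" if "k \<le> Suc m" for k
    using that
  proof (induction k)
    case (Suc k)
    then have "(c 0, c k) \<in> ?L\<^sup>*" "(c k, c (Suc k)) \<in> ?L" using step by auto
    then show ?case by (rule rtrancl_into_rtrancl)
  qed simp
  have "approximates X g \<sigma> (c 0)" "approximates X g' \<sigma> (c (Suc m))"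
    using c(2)[of 0] c(2)[of "Suc m"] unfolding f0 f1 by simp_all
  then have "linked i (c 0)" "linked j (c (Suc m))"
    using \<sigma>i(2) \<sigma>j(2) approximates_mono \<sigma>(3,4) by blast+
  then have "(i, c 0) \<in> ?L" "(c (Suc m), j) \<in> ?L"
    using i(1) j(1) c(1)[of 0] c(1)[of "Suc m"] linked_sym by auto
  then show ?thesis
    using chain[of "Suc m"] by (meson order_refl converse_rtrancl_into_rtrancl rtrancl_into_rtrancl)
qed

text \<open>Every code on the chain has a realizing map, so the links compose as homotopies.\<close>

lemma linked_chain_homotopic:
  assumes X: "X \<subseteq> hilbert_cube" and i: "i \<in> codes X" "realizes X g i"
    and chain: "(i, j) \<in> {(a, b). a \<in> codes X \<and> b \<in> codes X \<and> linked a b}\<^sup>*" and j: "realizes X g' j"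
  shows "homotopic_with (\<lambda>_. True) (top_of_set X) Y g g'"
  using chain j
proof (induction arbitrary: g' rule: rtrancl_induct)
  case base
  then show ?case using realizes_unique[OF i(1) i(2)] by blast
next
  case (step k l)
  then have kl: "k \<in> codes X" "l \<in> codes X" "linked k l" by auto
  obtain f where f: "realizes X f k" using ex_realizer[OF kl(1) X] by blast
  have "homotopic_with (\<lambda>_. True) (top_of_set X) Y f g'"
    by (rule linked_homotopic[OF kl f step.prems])
  with step.IH[OF f] show ?case by (rule homotopic_with_trans)
qed

section \<open>The numbering and the enumerability of its relations\<close>

definition numbering :: "(nat \<Rightarrow> real) set \<Rightarrow> nat \<Rightarrow> ((nat \<Rightarrow> real) \<Rightarrow> 'b) set option" where
  "numbering X i = (if i \<in> codes X
    then Some {g. \<exists>f. realizes X f i \<and> homotopic_with (\<lambda>_. True) (top_of_set X) Y f g} else None)"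

lemma dom_numbering: "dom (numbering X) = codes X"
  by (auto simp: numbering_def split: if_splits)

text \<open>The union over all realizing maps in \<open>numbering\<close> is a single class by
  \<open>realizes_unique\<close>, so no map has to be chosen.\<close>

lemma numbering_eq:
  assumes "i \<in> codes X" "realizes X f i"
  shows "numbering X i = Some ({(f, g). homotopic_with (\<lambda>_. True) (top_of_set X) Y f g} `` {f})"
  using assms realizes_unique[OF assms(1)] homotopic_with_trans
  unfolding numbering_def by (simp add: Image_singleton) blast

lemma ran_numbering:
  assumes X: "compact X" "X \<subseteq> hilbert_cube"
  shows "ran (numbering X) = homotopy_classes (top_of_set X) Y"
proof
  show "ran (numbering X) \<subseteq> homotopy_classes (top_of_set X) Y"
  proof
    fix \<Phi> assume "\<Phi> \<in> ran (numbering X)"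
    then obtain i where i: "numbering X i = Some \<Phi>" by (auto simp: ran_def)
    then have "i \<in> codes X" using dom_numbering by blast
    moreover from this obtain f where f: "realizes X f i" using ex_realizer[OF _ X(2)] by blast
    ultimately have "\<Phi> = {(f, g). homotopic_with (\<lambda>_. True) (top_of_set X) Y f g} `` {f}"
      using numbering_eq i by simp
    moreover have "f \<in> {f. continuous_map (top_of_set X) Y f}" using f by (simp add: realizes_def)
    ultimately show "\<Phi> \<in> homotopy_classes (top_of_set X) Y"
      unfolding homotopy_classes_def by (simp only: quotientI)
  qed
  show "homotopy_classes (top_of_set X) Y \<subseteq> ran (numbering X)"
  proof
    fix \<Phi> assume "\<Phi> \<in> homotopy_classes (top_of_set X) Y"
    then obtain f where f: "continuous_map (top_of_set X) Y f"
      "\<Phi> = {(f, g). homotopic_with (\<lambda>_. True) (top_of_set X) Y f g} `` {f}"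
      unfolding homotopy_classes_def by (auto elim!: quotientE)
    obtain i where "i \<in> codes X" "realizes X f i"
      using ex_approximating_code[OF X f(1) zero_less_one] by blast
    then show "\<Phi> \<in> ran (numbering X)" using numbering_eq f(2) by (auto intro: ranI)
  qed
qed

text \<open>This reduces a question about a realizing map to codes alone. It settles equality of
  classes on one space, and extension when \<open>f\<close> is the restriction of a map on a larger
  space.\<close>

lemma numbering_member_iff:
  assumes X: "compact X" "X \<subseteq> hilbert_cube" and i: "i \<in> codes X" "realizes X f i" and j: "j \<in> codes X"
  shows "f \<in> the (numbering X j) \<longleftrightarrow> (i, j) \<in> {(a, b). a \<in> codes X \<and> b \<in> codes X \<and> linked a b}\<^sup>*"
proof -
  obtain g where g: "realizes X g j" using ex_realizer[OF j X(2)] by blast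
  have "f \<in> the (numbering X j) \<longleftrightarrow> homotopic_with (\<lambda>_. True) (top_of_set X) Y f g"
    unfolding numbering_eq[OF j g] by (simp add: homotopic_with_sym[of _ _ _ f])
  then show ?thesis
    using homotopic_imp_linked[OF X i j g] linked_chain_homotopic[OF X(2) i _ g] by blast
qed

lemma numbering_eq_iff:
  assumes X: "compact X" "X \<subseteq> hilbert_cube" and i: "i \<in> codes X" and j: "j \<in> codes X"
  shows "numbering X i = numbering X j \<longleftrightarrow>
    (i, j) \<in> {(a, b). a \<in> codes X \<and> b \<in> codes X \<and> linked a b}\<^sup>*"
proof -
  obtain f g where f: "realizes X f i" and g: "realizes X g j"
    using ex_realizer[OF _ X(2)] i j by blast
  have "continuous_map (top_of_set X) Y f" "continuous_map (top_of_set X) Y g"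
    using f g by (simp_all add: realizes_def)
  then have "numbering X i = numbering X j \<longleftrightarrow> homotopic_with (\<lambda>_. True) (top_of_set X) Y f g"
    unfolding numbering_eq[OF i f] numbering_eq[OF j g]
    using eq_equiv_class_iff[OF equiv_homotopic, of f "top_of_set X" Y g] by simp
  also have "\<dots> \<longleftrightarrow> f \<in> the (numbering X j)"
    unfolding numbering_eq[OF j g] by (simp add: homotopic_with_sym[of _ _ _ f])
  finally show ?thesis using numbering_member_iff[OF X i f j] by simp
qed

lemma decidable_valid: "decidable valid"
  using decidable2_comp[OF decidable2_compatible[OF finite_close_labels] recursive_id recursive_id]
  by (simp add: valid_def[abs_def])

lemma decidable2_linked: "decidable2 linked"
  unfolding linked_def by (rule decidable2_compatible[OF finite_close_labels])

lemma mem_codes_iff: "i \<in> codes X \<longleftrightarrow> valid i \<and> p1 i \<in> upper_nbhds X"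
  by (simp add: codes_def upper_nbhds_def)

lemma links_codes:
  "links (\<lambda>a. valid a \<and> p1 a \<in> upper_nbhds X) linked =
    {(a, b). a \<in> codes X \<and> b \<in> codes X \<and> linked a b}"
  by (auto simp: links_def mem_codes_iff)

lemma numbering_ce_dom: "ce_relative (dom (numbering X)) X"
proof -
  have "enum_reducible {i. valid i \<and> p1 i \<in> upper_nbhds X} (upper_nbhds X)"
    by (rule enum_reducible_query[OF decidable_valid recursive_p1[OF recursive_id]])
  then show ?thesis
    unfolding ce_relative_def dom_numbering mem_codes_iff[symmetric] by simp
qed

lemma linked_in_codes:
  "(i, j) \<in> {(a, b). a \<in> codes X \<and> b \<in> codes X \<and> linked a b}\<^sup>* \<Longrightarrow> i \<in> codes X \<Longrightarrow> j \<in> codes X"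
  by (erule rtranclE) auto

lemma numbering_ce_eq:
  assumes X: "compact X" "X \<subseteq> hilbert_cube"
  shows "ce_relative (prod_encode ` {(i, j). i \<in> dom (numbering X) \<and> j \<in> dom (numbering X) \<and>
    numbering X i = numbering X j}) X"
proof -
  have eq: "{(i, j). i \<in> dom (numbering X) \<and> j \<in> dom (numbering X) \<and> numbering X i = numbering X j} =
    {(i, j). valid i \<and> p1 i \<in> upper_nbhds X \<and>
      (i, j) \<in> (links (\<lambda>a. valid a \<and> p1 a \<in> upper_nbhds X) linked)\<^sup>*}"
  proof -
    have "i \<in> codes X \<and> j \<in> codes X \<and> numbering X i = numbering X j \<longleftrightarrow>
        i \<in> codes X \<and> (i, j) \<in> {(a, b). a \<in> codes X \<and> b \<in> codes X \<and> linked a b}\<^sup>*" for i j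
      using numbering_eq_iff[OF X, of i j] linked_in_codes[of i j X] by satx
    then show ?thesis
      unfolding dom_numbering conj_assoc[of "valid _", symmetric] mem_codes_iff[symmetric]
      by (simp add: links_def)
  qed
  have "recursive2 (\<lambda>i a. p1 a)"
    unfolding recursive2_def by (intro recursive_intros)
  from enum_reducible_links(1)[OF decidable_valid decidable2_linked this, of "upper_nbhds X"]
  show ?thesis unfolding ce_relative_def eq .
qed

lemma mem_upper_nbhds_pair: "prod_encode (m, n) \<in> upper_nbhds_pair X A \<longleftrightarrow> m \<in> upper_nbhds X \<and> n \<in> upper_nbhds A"
  by (auto simp: upper_nbhds_pair_def upper_nbhds_def)

text \<open>A code of \<open>X\<close> is also a code of \<open>A\<close>, so every query about \<open>A\<close> can carry the single query
  \<open>p1 i\<close> about \<open>X\<close> along with it.\<close>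

lemma links_pair_iff:
  assumes "A \<subseteq> X"
  shows "valid i \<and> prod_encode (p1 i, p1 i) \<in> upper_nbhds_pair X A \<and>
      (i, j) \<in> (links (\<lambda>a. valid a \<and> prod_encode (p1 i, p1 a) \<in> upper_nbhds_pair X A) linked)\<^sup>* \<longleftrightarrow>
    i \<in> codes X \<and> (i, j) \<in> {(a, b). a \<in> codes A \<and> b \<in> codes A \<and> linked a b}\<^sup>*"
proof (cases "p1 i \<in> upper_nbhds X")
  case True
  then have "p1 i \<in> upper_nbhds A" using assms by (auto simp: upper_nbhds_def)
  with True show ?thesis
    by (simp add: mem_upper_nbhds_pair mem_codes_iff links_codes)
next
  case False
  then show ?thesis by (simp add: mem_upper_nbhds_pair mem_codes_iff)
qed

text \<open>A map realizing \<open>i\<close> on \<open>X\<close> also realizes \<open>i\<close> on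
  \<open>A\<close>; by \<open>class_extends_iff_restrict\<close>, extension means that it lies in
  the class of \<open>j\<close>.\<close>

lemma class_extends_iff_linked:
  assumes X: "compact X" "compact A" "A \<subseteq> X" "X \<subseteq> hilbert_cube" and i: "i \<in> codes X" and j: "j \<in> codes A"
  shows "class_extends X A Y (the (numbering X i)) (the (numbering A j)) \<longleftrightarrow>
    (i, j) \<in> {(a, b). a \<in> codes A \<and> b \<in> codes A \<and> linked a b}\<^sup>*"
proof -
  have A: "A \<subseteq> hilbert_cube" using X(3,4) by (rule subset_trans)
  obtain f where f: "realizes X f i" using ex_realizer[OF i X(4)] by blast
  have "the (numbering B k) \<in> ran (numbering B)" if "k \<in> codes B" for B k
    using that by (intro ranI[of _ k]) (simp add: numbering_def)
  then have "the (numbering X i) \<in> homotopy_classes (top_of_set X) Y"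
    "the (numbering A j) \<in> homotopy_classes (top_of_set A) Y"
    unfolding ran_numbering[OF X(1,4), symmetric] ran_numbering[OF X(2) A, symmetric]
    using i j by blast+
  moreover have "f \<in> the (numbering X i)"
    using numbering_member_iff[OF X(1,4) i f i] by simp
  ultimately have "class_extends X A Y (the (numbering X i)) (the (numbering A j)) \<longleftrightarrow>
      f \<in> the (numbering A j)"
    using class_extends_iff_restrict[OF X(3)] by blast
  moreover have "i \<in> codes A" using i codes_mono[OF X(3)] by blast
  ultimately show ?thesis
    using numbering_member_iff[OF X(2) A _ realizes_subset[OF f X(3)] j] by blast
qed

text \<open>A code over \<open>X\<close> of an extension is also a code over \<open>A\<close>, from
  which a chain leads to \<open>j\<close>. Conversely, a map realizing such a code on
  \<open>X\<close> lies in the class of \<open>j\<close> and is its own extension.\<close>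

lemma class_extendable_iff_linked:
  assumes X: "compact X" "compact A" "A \<subseteq> X" "X \<subseteq> hilbert_cube" and j: "j \<in> codes A"
  shows "class_extendable X A Y (the (numbering A j)) \<longleftrightarrow>
    (\<exists>i\<in>codes X. (i, j) \<in> {(a, b). a \<in> codes A \<and> b \<in> codes A \<and> linked a b}\<^sup>*)"
proof
  have A: "A \<subseteq> hilbert_cube" using X(3,4) by (rule subset_trans)
  obtain g where g: "realizes A g j" using ex_realizer[OF j A] by blast
  assume "class_extendable X A Y (the (numbering A j))"
  then obtain f F where f: "f \<in> the (numbering A j)" and F: "continuous_map (top_of_set X) Y F"
    and eq: "\<And>x. x \<in> A \<Longrightarrow> F x = f x"
    unfolding class_extendable_def by blast
  obtain i where i: "i \<in> codes X" "realizes X F i"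
    using ex_approximating_code[OF X(1,4) F zero_less_one] by blast
  have "i \<in> codes A" using i(1) codes_mono[OF X(3)] by blast
  have FA: "continuous_map (top_of_set A) Y F"
    using F X(3) by (rule continuous_map_from_subtopology_mono)
  have gf: "homotopic_with (\<lambda>_. True) (top_of_set A) Y g f"
    using f unfolding numbering_eq[OF j g] by simp
  have "homotopic_with (\<lambda>_. True) (top_of_set A) Y f F"
    using homotopic_with_imp_continuous_maps[OF gf] FA eq by (intro homotopic_with_equal) auto
  with gf have "homotopic_with (\<lambda>_. True) (top_of_set A) Y g F" by (rule homotopic_with_trans)
  then have "F \<in> the (numbering A j)" unfolding numbering_eq[OF j g] by simp
  then show "\<exists>i\<in>codes X. (i, j) \<in> {(a, b). a \<in> codes A \<and> b \<in> codes A \<and> linked a b}\<^sup>*"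
    using numbering_member_iff[OF X(2) A \<open>i \<in> codes A\<close> realizes_subset[OF i(2) X(3)] j] i(1) by blast
next
  have A: "A \<subseteq> hilbert_cube" using X(3,4) by (rule subset_trans)
  assume "\<exists>i\<in>codes X. (i, j) \<in> {(a, b). a \<in> codes A \<and> b \<in> codes A \<and> linked a b}\<^sup>*"
  then obtain i where i: "i \<in> codes X"
    "(i, j) \<in> {(a, b). a \<in> codes A \<and> b \<in> codes A \<and> linked a b}\<^sup>*" by blast
  obtain F where F: "realizes X F i" using ex_realizer[OF i(1) X(4)] by blast
  have "i \<in> codes A" using i(1) codes_mono[OF X(3)] by blast
  then have "F \<in> the (numbering A j)"
    using numbering_member_iff[OF X(2) A _ realizes_subset[OF F X(3)] j] i(2) by blast
  moreover have "continuous_map (top_of_set X) Y F" using F by (simp add: realizes_def)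
  ultimately show "class_extendable X A Y (the (numbering A j))"
    unfolding class_extendable_def by blast
qed

lemma numbering_ce_extends:
  assumes X: "compact X" "compact A" "A \<subseteq> X" "X \<subseteq> hilbert_cube"
  shows "ce_relative_pair (prod_encode ` {(i, j). i \<in> dom (numbering X) \<and> j \<in> dom (numbering A) \<and>
      class_extends X A Y (the (numbering X i)) (the (numbering A j))}) X A" (is ?extends)
    and "ce_relative_pair {j \<in> dom (numbering A). class_extendable X A Y (the (numbering A j))} X A"
      (is ?extendable)
proof -
  have rec: "recursive2 (\<lambda>i a. prod_encode (p1 i, p1 a))"
    unfolding recursive2_def by (intro recursive_intros)
  have codes_A: "j \<in> codes A" if "i \<in> codes X"
    "(i, j) \<in> {(a, b). a \<in> codes A \<and> b \<in> codes A \<and> linked a b}\<^sup>*" for i j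
    using linked_in_codes[OF that(2)] that(1) codes_mono[OF X(3)] by blast
  have "{(i, j). i \<in> dom (numbering X) \<and> j \<in> dom (numbering A) \<and>
      class_extends X A Y (the (numbering X i)) (the (numbering A j))} =
    {(i, j). i \<in> codes X \<and> (i, j) \<in> {(a, b). a \<in> codes A \<and> b \<in> codes A \<and> linked a b}\<^sup>*}"
    unfolding dom_numbering using class_extends_iff_linked[OF X] codes_A by blast
  then show ?extends
    using enum_reducible_links(1)[OF decidable_valid decidable2_linked rec, of "upper_nbhds_pair X A"]
    unfolding ce_relative_pair_def links_pair_iff[OF X(3)] by simp
  have "{j \<in> dom (numbering A). class_extendable X A Y (the (numbering A j))} =
    {j. \<exists>i. i \<in> codes X \<and> (i, j) \<in> {(a, b). a \<in> codes A \<and> b \<in> codes A \<and> linked a b}\<^sup>*}"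
    unfolding dom_numbering using class_extendable_iff_linked[OF X] codes_A by blast
  then show ?extendable
    using enum_reducible_links(2)[OF decidable_valid decidable2_linked rec, of "upper_nbhds_pair X A"]
    unfolding ce_relative_pair_def links_pair_iff[OF X(3)] by simp
qed

end

theorem theorem6p7:
  fixes Y :: "'b topology"
  assumes "compact_ANR Y"
  shows "\<exists>\<nu> :: (nat \<Rightarrow> real) set \<Rightarrow> nat \<Rightarrow> ((nat \<Rightarrow> real) \<Rightarrow> 'b) set option.
    (\<forall>X. compact X \<and> X \<subseteq> hilbert_cube \<longrightarrow>
       ran (\<nu> X) = homotopy_classes (top_of_set X) Y \<and>
       ce_relative (dom (\<nu> X)) X \<and>
       ce_relative (prod_encode ` {(i, j). i \<in> dom (\<nu> X) \<and> j \<in> dom (\<nu> X) \<and> \<nu> X i = \<nu> X j}) X) \<and>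
    (\<forall>X A. compact X \<and> compact A \<and> A \<subseteq> X \<and> X \<subseteq> hilbert_cube \<longrightarrow>
       ce_relative_pair (prod_encode ` {(i, j). i \<in> dom (\<nu> X) \<and> j \<in> dom (\<nu> A) \<and>
          class_extends X A Y (the (\<nu> X i)) (the (\<nu> A j))}) X A \<and>
       ce_relative_pair {i \<in> dom (\<nu> A). class_extendable X A Y (the (\<nu> A i))} X A)"
proof -
  obtain S U e e' r s M \<epsilon> \<delta> \<eta> where "retract_net Y S U e e' r s M \<epsilon> \<delta> \<eta>"
    using compact_ANR_retract_net[OF assms] by (elim exE)
  then interpret retract_net Y S U e e' r s M \<epsilon> \<delta> \<eta> .
  show ?thesis
    by (intro exI[of _ numbering] conjI allI impI; elim conjE)
      (rule ran_numbering numbering_ce_dom numbering_ce_eq numbering_ce_extends; assumption)+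
qed

end
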